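(* Let $\eta<\xi$ and let $f:[\eta,\xi]\to\mathbb{R}$ be such that $f''$ is continuous on $[\eta,\xi]$ and bounded away from $0$ there (one-sided derivatives at the endpoints). For $Q\ge 1$ and $\delta>0$ let $$N(Q,\delta)=\mathrm{card}\{(a,q)\in\mathbb{Z}\times\mathbb{N} : q\le Q,\ \eta q<a\le \xi q,\ \|qf(a/q)\|<\delta\}.$$ Then for all $Q\ge 1$ and $0<\delta<\tfrac12$, $$N(Q,\delta)\ll \delta Q^2+\delta^{-1/2}Q,$$ where the implied constant depends only on $f,\eta,\xi$.
   Context: $\|x\|=\min\{|x-m|:m\in\mathbb{Z}\}$ denotes the distance from $x$ to the nearest integer. *)

theory Defs
  imports Complex_Main
begin

definition dist_int :: "real \<Rightarrow> real"
  where "dist_int x = (INF m::int. \<bar>x - of_int m\<bar>)"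

text \<open>The infimum is a minimum.\<close>

lemma dist_int_le: "dist_int x \<le> \<bar>x - of_int m\<bar>"
  unfolding dist_int_def by (rule cINF_lower) (auto intro!: bdd_belowI[of _ 0])

lemma dist_int_attained: "\<exists>m::int. dist_int x = \<bar>x - of_int m\<bar>"
proof -
  have *: "\<bar>x - of_int (round x)\<bar> \<le> \<bar>x - of_int m\<bar>" for m :: int
    by (rule round_diff_minimal)
  have "\<bar>x - of_int (round x)\<bar> \<le> dist_int x"
    unfolding dist_int_def by (rule cINF_greatest) (use * in auto)
  with dist_int_le[of x "round x"] show ?thesis
    by (intro exI[of _ "round x"]) linarith
qed

definition near_points :: "(real \<Rightarrow> real) \<Rightarrow> real \<Rightarrow> real \<Rightarrow> real \<Rightarrow> real \<Rightarrow> (int \<times> nat) set"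
  where "near_points f \<eta> \<xi> Q \<delta> =
    {(a, q). 1 \<le> q \<and> real q \<le> Q \<and> \<eta> * real q < of_int a \<and> of_int a \<le> \<xi> * real q \<and>
       dist_int (real q * f (of_int a / real q)) < \<delta>}"

definition near_count :: "(real \<Rightarrow> real) \<Rightarrow> real \<Rightarrow> real \<Rightarrow> real \<Rightarrow> real \<Rightarrow> nat"
  where "near_count f \<eta> \<xi> Q \<delta> = card (near_points f \<eta> \<xi> Q \<delta>)"

text \<open>The set is finite, so its \<^const>\<open>card\<close> is the true cardinality.\<close>

lemma finite_near_points: "finite (near_points f \<eta> \<xi> Q \<delta>)"
proof (rule finite_subset)
  show "near_points f \<eta> \<xi> Q \<delta> \<subseteq>
    (SIGMA q:{..nat \<lfloor>Q\<rfloor>}. {\<lfloor>\<eta> * real q\<rfloor>..\<lceil>\<xi> * real q\<rceil>})\<inverse>"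
    unfolding near_points_def by (auto simp: le_nat_floor) linarith+
  show "finite ((SIGMA q:{..nat \<lfloor>Q\<rfloor>}. {\<lfloor>\<eta> * real q\<rfloor>..\<lceil>\<xi> * real q\<rceil>})\<inverse>)"
    by (intro finite_converse[THEN iffD2] finite_SigmaI) auto
qed

end

theory Submission
  imports Defs "HOL-Analysis.Analysis"
begin

text \<open>
  Extend \<open>f\<close> to a function on the whole line whose difference quotients of the derivative lie
  between two positive constants, and view a point as an integer vector \<open>(q, a, p)\<close> with
  \<open>\<bar>q f(a/q) - p\<bar> \<le> \<delta>\<close>; primitive vectors with \<open>Q/2 < q \<le> Q\<close> are counted first. Three of them whose
  abscissae \<open>a/q\<close> differ by less than a constant times \<open>1 / (\<delta>Q\<^sup>2 + Q)\<close> have determinant \<open>0\<close>, so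
  the count reduces to planes \<open>j p = k a - n q\<close>. On such a plane \<open>F(x) = j f(x) - k x + n\<close> is tiny at
  every point, the abscissae are \<open>j/Q\<^sup>2\<close>-separated, and every point in the wider strip
  \<open>\<bar>F\<bar> \<le> 1/(4Q)\<close> lies on the plane. If \<open>F\<close> crosses this strip, the strip is long in comparison with
  the number of points, and since the strips overlap at most twice these planes contribute
  \<open>O(\<delta>Q\<^sup>2 + Q)\<close>. Otherwise the minimum of \<open>F\<close> lies in the strip; then \<open>(j, k, n)\<close> is a point near
  the dual curve, the graph of the Legendre transform of \<open>f\<close>, with \<open>1/(4Q)\<close> in place of \<open>\<delta>\<close>.

  For \<open>\<delta> \<le> 1/(4Q)\<close> the bound \<open>O(Q\<^bsup>1+s\<^esup>)\<close> is trivial with \<open>s = 1\<close>, and a bound with exponent \<open>s\<close>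
  for the dual curve yields one with exponent \<open>s/(1+s)\<close>. Exponent \<open>1/4\<close> suffices: it leads to
  \<open>O(\<delta>Q\<^sup>2 + Q + Q\<^bsup>3/2\<^esup>\<delta>\<^bsup>1/4\<^esup>)\<close> primitive vectors, whose last term is the geometric mean of the two
  terms of the theorem, and the sum over common factors and dyadic ranges converges.
\<close>

section \<open>Functions with pinched second derivative\<close>

text \<open>This is \<open>l\<close> \<le> f'' \<le> \<open>L\<close> with \<open>g\<close> in the
  role of f', phrased without derivatives. The class therefore admits second derivatives with jumps
  and is closed under the Legendre transform.\<close>

definition pinched :: "(real \<Rightarrow> real) \<Rightarrow> (real \<Rightarrow> real) \<Rightarrow> real \<Rightarrow> real \<Rightarrow> bool"
  where "pinched f g l L \<longleftrightarrow> 0 < l \<and> (\<forall>x y.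
    f x + g x * (y - x) + l / 2 * (y - x)\<^sup>2 \<le> f y \<and>
    f y \<le> f x + g x * (y - x) + L / 2 * (y - x)\<^sup>2)"

lemma pinched_pos: "pinched f g l L \<Longrightarrow> 0 < l"
  and pinched_lower: "pinched f g l L \<Longrightarrow> f x + g x * (y - x) + l / 2 * (y - x)\<^sup>2 \<le> f y"
  and pinched_upper: "pinched f g l L \<Longrightarrow> f y \<le> f x + g x * (y - x) + L / 2 * (y - x)\<^sup>2"
  by (auto simp: pinched_def)

lemma pinched_le:
  assumes "pinched f g l L"
  shows "l \<le> L"
  using pinched_lower[OF assms, of 0 1] pinched_upper[OF assms, of 1 0] by simp

text \<open>Adding the quadratic bounds taken from \<open>x\<close> and from \<open>y\<close>
  cancels the values of \<open>f\<close>.\<close>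

lemma pinched_slope:
  assumes "pinched f g l L"
  shows "l * (y - x)\<^sup>2 \<le> (g y - g x) * (y - x)" "(g y - g x) * (y - x) \<le> L * (y - x)\<^sup>2"
  using pinched_lower[OF assms, of x y] pinched_lower[OF assms, of y x]
    pinched_upper[OF assms, of x y] pinched_upper[OF assms, of y x]
  by (simp_all add: algebra_simps power2_eq_square)

lemma pinched_slope_le:
  assumes "pinched f g l L" "x \<le> y"
  shows "l * (y - x) \<le> g y - g x" "g y - g x \<le> L * (y - x)"
proof -
  have "l * (y - x) \<le> g y - g x \<and> g y - g x \<le> L * (y - x)"
  proof (cases "x = y")
    case False
    then have "0 < y - x" using assms by simp
    with pinched_slope[OF assms(1), where x = x and y = y] show ?thesis
      by (simp add: power2_eq_square flip: mult.assoc)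
  qed simp
  then show "l * (y - x) \<le> g y - g x" "g y - g x \<le> L * (y - x)" by auto
qed

lemma pinched_slope_mono:
  assumes "pinched f g l L"
  shows "x \<le> y \<Longrightarrow> g x \<le> g y"
  using pinched_slope_le(1)[OF assms, of x y] pinched_pos[OF assms]
  by (smt (verit) mult_nonneg_nonneg)

lemma pinched_slope_abs:
  assumes "pinched f g l L"
  shows "\<bar>g y - g x\<bar> \<le> L * \<bar>y - x\<bar>" "l * \<bar>y - x\<bar> \<le> \<bar>g y - g x\<bar>"
  using pinched_slope_le[OF assms, of x y] pinched_slope_le[OF assms, of y x]
    pinched_slope_mono[OF assms, of x y] pinched_slope_mono[OF assms, of y x]
  by (cases "x \<le> y"; simp)+

lemma pinched_slope_surj:
  assumes "pinched f g l L"
  shows "\<exists>x. g x = s"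
proof -
  have l: "0 < l" and lL: "l \<le> L" using pinched_pos pinched_le assms by auto
  have "L-lipschitz_on UNIV g"
    using pinched_slope_abs(1)[OF assms] l lL
    by (auto simp: lipschitz_on_def dist_real_def)
  then have cont: "continuous_on S g" for S
    using lipschitz_on_continuous_on continuous_on_subset by blast
  \<comment> \<open>As \<open>g\<close> grows at rate at least \<open>l\<close>, a step of length
    \<open>t\<close> away from 0 makes up for both \<open>\<bar>g 0\<bar>\<close> and
    \<open>\<bar>s\<bar>\<close>.\<close>
  define t where "t = (\<bar>s\<bar> + \<bar>g 0\<bar>) / l"
  have t: "0 \<le> t" "l * t = \<bar>s\<bar> + \<bar>g 0\<bar>" using l by (auto simp: t_def)
  have "g (-t) \<le> s" "s \<le> g t"
    using pinched_slope_le(1)[OF assms, of "-t" 0] pinched_slope_le(1)[OF assms, of 0 t] t by auto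
  then show ?thesis
    using IVT'[of g "-t" s t] t cont by auto
qed

text \<open>For pinched \<open>f\<close> this is the inverse function of \<open>g\<close>, which is
  the derivative of the Legendre transform.\<close>

definition conj_slope :: "(real \<Rightarrow> real) \<Rightarrow> real \<Rightarrow> real"
  where "conj_slope g s = (SOME x. g x = s)"

definition legendre :: "(real \<Rightarrow> real) \<Rightarrow> (real \<Rightarrow> real) \<Rightarrow> real \<Rightarrow> real"
  where "legendre f g s = s * conj_slope g s - f (conj_slope g s)"

lemma slope_conj_slope:
  assumes "pinched f g l L"
  shows "g (conj_slope g s) = s"
  unfolding conj_slope_def using someI_ex[OF pinched_slope_surj[OF assms]] .

text \<open>If \<open>g x = s\<close> and \<open>g y = t\<close>, the remainder of the transform at
  \<open>t\<close>, expanded from \<open>s\<close>, is the remainder of \<open>f\<close> at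
  \<open>x\<close>, expanded from \<open>y\<close>. The slope bounds convert
  \<open>\<bar>x - y\<bar>\<close> into \<open>\<bar>t - s\<bar>\<close>; the constants are cruder
  than 1/L and 1/l.\<close>

lemma pinched_legendre:
  assumes "pinched f g l L"
  shows "pinched (legendre f g) (conj_slope g) (l / L\<^sup>2) (L / l\<^sup>2)"
  unfolding pinched_def
proof (intro conjI allI)
  have l: "0 < l" and lL: "l \<le> L" using pinched_pos pinched_le assms by auto
  then have L: "0 < L" by simp
  show "0 < l / L\<^sup>2" using l L by simp
  fix s t
  define x y where "x = conj_slope g s" and "y = conj_slope g t"
  have s: "s = g x" and t: "t = g y" unfolding x_def y_def
    using slope_conj_slope[OF assms] by auto
  have eq: "legendre f g t - legendre f g s - conj_slope g s * (t - s) =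
      f x - (f y + g y * (x - y))"
    unfolding legendre_def x_def[symmetric] y_def[symmetric]
    unfolding s t by (simp add: algebra_simps)
  have "\<bar>t - s\<bar>\<^sup>2 \<le> (L * \<bar>x - y\<bar>)\<^sup>2"
    using pinched_slope_abs(1)[OF assms, of x y] by (intro power_mono) (auto simp: s t)
  then have "(t - s)\<^sup>2 / L\<^sup>2 \<le> (x - y)\<^sup>2"
    using L by (simp add: power_mult_distrib field_simps)
  then have "l / 2 * ((t - s)\<^sup>2 / L\<^sup>2) \<le> l / 2 * (x - y)\<^sup>2"
    using l by (intro mult_left_mono) auto
  moreover have "(l * \<bar>x - y\<bar>)\<^sup>2 \<le> \<bar>t - s\<bar>\<^sup>2"
    using pinched_slope_abs(2)[OF assms, of x y] l by (intro power_mono) (auto simp: s t)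
  then have "(x - y)\<^sup>2 \<le> (t - s)\<^sup>2 / l\<^sup>2"
    using l by (simp add: power_mult_distrib field_simps)
  then have "L / 2 * (x - y)\<^sup>2 \<le> L / 2 * ((t - s)\<^sup>2 / l\<^sup>2)"
    using L by (intro mult_left_mono) auto
  moreover have "l / L\<^sup>2 / 2 * (t - s)\<^sup>2 = l / 2 * ((t - s)\<^sup>2 / L\<^sup>2)"
    "L / l\<^sup>2 / 2 * (t - s)\<^sup>2 = L / 2 * ((t - s)\<^sup>2 / l\<^sup>2)" by simp_all
  ultimately show "legendre f g s + conj_slope g s * (t - s) + l / L\<^sup>2 / 2 * (t - s)\<^sup>2 \<le> legendre f g t"
    "legendre f g t \<le> legendre f g s + conj_slope g s * (t - s) + L / l\<^sup>2 / 2 * (t - s)\<^sup>2"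
    using eq pinched_lower[OF assms, of y x] pinched_upper[OF assms, of x y] by linarith+
qed

section \<open>Counting spaced points and overlapping intervals\<close>

lemma card_spaced_le:
  fixes x :: "'a \<Rightarrow> real"
  assumes "finite S" "0 < s" "0 \<le> R"
    and sep: "\<And>v w. v \<in> S \<Longrightarrow> w \<in> S \<Longrightarrow> v \<noteq> w \<Longrightarrow> s \<le> \<bar>x v - x w\<bar>"
    and diam: "\<And>v w. v \<in> S \<Longrightarrow> w \<in> S \<Longrightarrow> \<bar>x v - x w\<bar> \<le> R"
  shows "real (card S) \<le> R / s + 1"
proof (cases "S = {}")
  case False
  define b where "b = Min (x ` S)"
  have b: "b \<le> x v" if "v \<in> S" for v unfolding b_def using assms that by auto
  have "b \<in> x ` S" unfolding b_def using assms False by (intro Min_in) auto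
  then obtain w where w: "w \<in> S" "b = x w" by auto
  \<comment> \<open>\<open>?n\<close> numbers the half-open intervals of length \<open>s\<close>
    that start at the smallest value; the spacing leaves at most one point in each.\<close>
  let ?n = "\<lambda>v. \<lfloor>(x v - b) / s\<rfloor>"
  have "inj_on ?n S"
  proof (rule inj_onI, rule ccontr)
    fix v u assume *: "v \<in> S" "u \<in> S" "?n v = ?n u" "v \<noteq> u"
    then have "\<bar>(x v - b) / s - (x u - b) / s\<bar> < 1" by linarith
    then have "\<bar>x v - x u\<bar> / s < 1" using assms(2)
      by (simp add: diff_divide_distrib[symmetric] abs_divide)
    then show False using sep[of v u] * assms(2) by (simp add: field_simps)
  qed
  moreover have "?n ` S \<subseteq> {0..\<lfloor>R / s\<rfloor>}"
  proof (intro image_subsetI)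
    fix v assume v: "v \<in> S"
    have "(x v - b) / s \<le> R / s" using diam[of v w] v w assms(2) by (intro divide_right_mono) auto
    then have "?n v \<le> \<lfloor>R / s\<rfloor>" by (rule floor_mono)
    then show "?n v \<in> {0..\<lfloor>R / s\<rfloor>}" using b[OF v] assms(2) by simp
  qed
  ultimately have "card S \<le> card {0..\<lfloor>R / s\<rfloor>}" by (intro card_inj_on_le) auto
  moreover have "0 \<le> R / s" using assms by simp
  ultimately show ?thesis by simp linarith
qed (use assms in auto)

lemma card_int_interval_le:
  fixes a b :: real
  assumes "a \<le> b"
  shows "finite {k::int. a \<le> k \<and> k \<le> b}" "real (card {k::int. a \<le> k \<and> k \<le> b}) \<le> b - a + 1"
proof -
  have "{k::int. a \<le> k \<and> k \<le> b} \<subseteq> {\<lceil>a\<rceil>..\<lfloor>b\<rfloor>}" by (auto simp: ceiling_le_iff le_floor_iff)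
  then show fin: "finite {k::int. a \<le> k \<and> k \<le> b}" using finite_subset by blast
  have "real (card {k::int. a \<le> k \<and> k \<le> b}) \<le> (b - a) / 1 + 1"
  proof (rule card_spaced_le[OF fin, where x = real_of_int])
    fix v w :: int assume "v \<noteq> w"
    then have "1 \<le> \<bar>v - w\<bar>" by linarith
    then show "1 \<le> \<bar>real_of_int v - real_of_int w\<bar>" by linarith
  qed (use assms in auto)
  then show "real (card {k::int. a \<le> k \<and> k \<le> b}) \<le> b - a + 1" by simp
qed

text \<open>Integrate the sum of the indicator functions of the intervals, which is at most
  \<open>n\<close> everywhere.\<close>

lemma sum_lengths_le:
  fixes \<alpha> \<beta> :: "'c \<Rightarrow> real"
  assumes "finite C" "a \<le> b"
    and sub: "\<And>c. c \<in> C \<Longrightarrow> a \<le> \<alpha> c \<and> \<alpha> c \<le> \<beta> c \<and> \<beta> c \<le> b"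
    and mult: "\<And>x. card {c \<in> C. \<alpha> c \<le> x \<and> x \<le> \<beta> c} \<le> n"
  shows "(\<Sum>c\<in>C. \<beta> c - \<alpha> c) \<le> real n * (b - a)"
proof -
  let ?g = "\<lambda>c x. indicator {\<alpha> c..\<beta> c} x :: real"
  have "(?g c has_integral (\<beta> c - \<alpha> c)) {a..b}" if "c \<in> C" for c
  proof -
    have "((\<lambda>x. 1::real) has_integral (\<beta> c - \<alpha> c)) {\<alpha> c..\<beta> c}"
      using has_integral_const_real[of "1::real" "\<alpha> c" "\<beta> c"] sub[OF that] by simp
    then have "((\<lambda>x. if x \<in> {\<alpha> c..\<beta> c} then 1 else 0::real) has_integral (\<beta> c - \<alpha> c)) {a..b}"
      using sub[OF that] by (subst has_integral_restrict) auto
    then show ?thesis by (simp add: indicator_def of_bool_def)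
  qed
  then have 1: "((\<lambda>x. \<Sum>c\<in>C. ?g c x) has_integral (\<Sum>c\<in>C. \<beta> c - \<alpha> c)) {a..b}"
    by (intro has_integral_sum[OF assms(1)])
  have 2: "((\<lambda>x. real n) has_integral (real n * (b - a))) {a..b}"
    using has_integral_const_real[of "real n" a b] assms(2) by (simp add: mult.commute)
  have "(\<Sum>c\<in>C. ?g c x) \<le> real n" for x
  proof -
    have "(\<Sum>c\<in>C. ?g c x) = real (card {c \<in> C. \<alpha> c \<le> x \<and> x \<le> \<beta> c})"
      using assms(1) by (simp add: indicator_def of_bool_def sum.If_cases Int_def)
    then show ?thesis using mult[of x] by simp
  qed
  then show ?thesis using has_integral_le[OF 1 2] by auto
qed

section \<open>Integer triples and planes\<close>

text \<open>\<open>p\<close> is an integer close to q f(a/q). The dyadic range makes every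
  \<open>q\<close> comparable to \<open>Q\<close>, and the weak inequalities are those that the dual
  curve yields.\<close>

definition near_triples :: "(real \<Rightarrow> real) \<Rightarrow> real \<Rightarrow> real \<Rightarrow> real \<Rightarrow> real \<Rightarrow> (int \<times> int \<times> int) set"
  where "near_triples f A B Q d = {(q, a, p).
    Q / 2 < of_int q \<and> of_int q \<le> Q \<and> A * of_int q \<le> of_int a \<and> of_int a \<le> B * of_int q \<and>
    \<bar>of_int q * f (of_int a / of_int q) - of_int p\<bar> \<le> d}"

definition primitive :: "int \<times> int \<times> int \<Rightarrow> bool"
  where "primitive = (\<lambda>(q, a, p). gcd q (gcd a p) = 1)"

definition prim_triples :: "(real \<Rightarrow> real) \<Rightarrow> real \<Rightarrow> real \<Rightarrow> real \<Rightarrow> real \<Rightarrow> (int \<times> int \<times> int) set"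
  where "prim_triples f A B Q d = {v \<in> near_triples f A B Q d. primitive v}"

definition abscissa :: "int \<times> int \<times> int \<Rightarrow> real"
  where "abscissa = (\<lambda>(q, a, p). of_int a / of_int q)"

text \<open>In the coordinates (a/q, p/q) this is the line of slope k/j and intercept -l/j. With
  this sign \<open>(j, k, l)\<close> is itself a triple with abscissa k/j and ordinate l/j, as
  needed for the dual curve.\<close>

definition on_plane :: "int \<times> int \<times> int \<Rightarrow> int \<times> int \<times> int \<Rightarrow> bool"
  where "on_plane = (\<lambda>(j, k, l) (q, a, p). j * p = k * a - l * q)"

text \<open>By Bezout \<open>w\<close> is an integer combination of \<open>j * w\<close>,
  \<open>k * w\<close> and \<open>l * w\<close>.\<close>

lemma primitive_dvd:
  assumes "primitive (j, k, l)" "n dvd j * w" "n dvd k * w" "n dvd l * w"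
  shows "n dvd w"
proof -
  obtain u v where "u * j + v * gcd k l = 1"
    using assms(1) bezout_int[of j "gcd k l"] by (auto simp: primitive_def)
  moreover obtain s t where "s * k + t * l = gcd k l" using bezout_int by blast
  ultimately have "u * j + v * (s * k + t * l) = 1" by simp
  then have "w = (u * j + v * (s * k + t * l)) * w" by simp
  also have "\<dots> = u * (j * w) + v * (s * (k * w) + t * (l * w))" by (simp add: algebra_simps)
  finally have w: "w = u * (j * w) + v * (s * (k * w) + t * (l * w))" .
  show ?thesis by (subst w) (intro dvd_add dvd_mult assms(2-4))
qed

text \<open>\<open>primitive_dvd\<close> makes the two first entries divide each other; once they
  agree, so do the others.\<close>

lemma primitive_parallel_eq:
  assumes "primitive (q, a, p)" "primitive (q', a', p')" "0 < q" "0 < q'"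
    and "q * a' = q' * a" "q * p' = q' * p"
  shows "(q, a, p) = (q', a', p')"
proof -
  have e: "a * q' = q * a'" "p * q' = q * p'" "a' * q = q' * a" "p' * q = q' * p"
    using assms(5,6) by (simp_all add: mult.commute)
  have "q dvd q'" by (rule primitive_dvd[OF assms(1)]) (simp_all add: e(1,2))
  moreover have "q' dvd q" by (rule primitive_dvd[OF assms(2)]) (simp_all add: e(3,4))
  ultimately have "q = q'" using assms by (simp add: zdvd_antisym_nonneg)
  then show ?thesis using assms by auto
qed

text \<open>The cross product of two vectors of the plane is parallel to the normal, and the normal
  is primitive, so its first entry divides that of the product. This is the source of the spacing of
  points on a plane.\<close>

lemma plane_dvd:
  assumes "primitive (j, k, l)" "on_plane (j, k, l) (q, a, p)" "on_plane (j, k, l) (q', a', p')"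
  shows "j dvd q * a' - q' * a"
proof (rule primitive_dvd[OF assms(1)])
  have e: "j * p = k * a - l * q" "j * p' = k * a' - l * q'"
    using assms(2,3) by (auto simp: on_plane_def)
  have "k * (q * a' - q' * a) = q * (j * p') - q' * (j * p)"
    unfolding e by (simp add: algebra_simps)
  also have "\<dots> = j * (q * p' - q' * p)" by (simp add: algebra_simps)
  finally show "j dvd k * (q * a' - q' * a)" by simp
  have "l * (q * a' - q' * a) = a * (j * p') - a' * (j * p)"
    unfolding e by (simp add: algebra_simps)
  also have "\<dots> = j * (a * p' - a' * p)" by (simp add: algebra_simps)
  finally show "j dvd l * (q * a' - q' * a)" by simp
qed simp

definition det3 :: "int \<times> int \<times> int \<Rightarrow> int \<times> int \<times> int \<Rightarrow> int \<times> int \<times> int \<Rightarrow> int"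
  where "det3 = (\<lambda>(q1, a1, p1) (q2, a2, p2) (q3, a3, p3).
    q1 * (a2 * p3 - a3 * p2) - a1 * (q2 * p3 - q3 * p2) + p1 * (q2 * a3 - q3 * a2))"

text \<open>The normal is the cross product of the two vectors divided by the gcd of its
  entries.\<close>

lemma plane_through:
  assumes "q * a' \<noteq> q' * a"
  obtains j k l where "primitive (j, k, l)" "1 \<le> j" "j \<le> \<bar>q * a' - q' * a\<bar>"
    "\<And>u. det3 u (q, a, p) (q', a', p') = 0 \<Longrightarrow> on_plane (j, k, l) u"
proof -
  define j0 k0 l0 where "j0 = q * a' - q' * a" and "k0 = q * p' - q' * p" and "l0 = a * p' - a' * p"
  \<comment> \<open>The sign is included to make \<open>j\<close> positive.\<close>
  define h where "h = sgn j0 * gcd j0 (gcd k0 l0)"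
  have j0: "j0 \<noteq> 0" using assms by (simp add: j0_def)
  then have h0: "h \<noteq> 0" by (simp add: h_def sgn_if)
  have "h dvd j0" "h dvd k0" "h dvd l0"
    unfolding h_def using j0 by (auto simp: sgn_if intro: gcd_dvd1 dvd_trans[OF gcd_dvd2])
  then obtain j k l where jkl: "j0 = h * j" "k0 = h * k" "l0 = h * l" by (auto elim!: dvdE)
  have h: "\<bar>h\<bar> = gcd j0 (gcd k0 l0)" using j0 by (simp add: h_def abs_mult sgn_if)
  let ?g = "gcd j (gcd k l)"
  have "?g dvd j" "?g dvd k" "?g dvd l" by (auto intro: dvd_trans[OF gcd_dvd2])
  then have "h * ?g dvd gcd j0 (gcd k0 l0)"
    unfolding jkl by (intro gcd_greatest mult_dvd_mono dvd_refl)
  then have "h * ?g dvd h * 1" by (simp add: h[symmetric])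
  then have "?g dvd 1" using h0 by (simp only: dvd_mult_cancel_left) blast
  then have "primitive (j, k, l)" by (simp add: primitive_def)
  moreover have "h * j0 = \<bar>j0\<bar> * \<bar>h\<bar>" unfolding h by (simp add: h_def abs_sgn mult_ac)
  then have "0 < h * j0" using j0 h0 by simp
  then have "0 < h * h * j" by (simp add: jkl(1) mult.assoc)
  then have "1 \<le> j" using h0 by (simp add: zero_less_mult_iff)
  moreover have "j \<le> \<bar>q * a' - q' * a\<bar>"
    unfolding j0_def[symmetric] jkl(1) abs_mult using \<open>1 \<le> j\<close> h0
    by (simp add: mult_le_cancel_right1)
  moreover have "on_plane (j, k, l) u" if "det3 u (q, a, p) (q', a', p') = 0" for u
  proof -
    obtain q1 a1 p1 where u: "u = (q1, a1, p1)" by (cases u)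
    have "q1 * l0 - a1 * k0 + p1 * j0 = 0"
      using that by (simp add: u det3_def j0_def k0_def l0_def)
    moreover have "h * (q1 * l - a1 * k + p1 * j) = q1 * l0 - a1 * k0 + p1 * j0"
      by (simp add: jkl algebra_simps)
    ultimately have "q1 * l - a1 * k + p1 * j = 0" using h0 by (metis mult_eq_0_iff)
    then show ?thesis by (simp add: u on_plane_def algebra_simps)
  qed
  ultimately show ?thesis using that by blast
qed

text \<open>Both normals are parallel to the nonzero cross product of the two vectors, and parallel
  primitive vectors with positive first entries coincide.\<close>

lemma plane_unique:
  assumes "q * a' \<noteq> q' * a"
    and "primitive (j, k, l)" "primitive (j', k', l')" "0 < j" "0 < j'"
    and "on_plane (j, k, l) (q, a, p)" "on_plane (j, k, l) (q', a', p')"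
    and "on_plane (j', k', l') (q, a, p)" "on_plane (j', k', l') (q', a', p')"
  shows "(j, k, l) = (j', k', l')"
proof -
  have *: "j * (q * p' - q' * p) = k * (q * a' - q' * a) \<and>
    j * (a * p' - a' * p) = l * (q * a' - q' * a)"
    if "on_plane (j, k, l) (q, a, p)" "on_plane (j, k, l) (q', a', p')" for j k l
  proof -
    have e: "j * p = k * a - l * q" "j * p' = k * a' - l * q'"
      using that by (auto simp: on_plane_def)
    have "j * (q * p' - q' * p) = q * (j * p') - q' * (j * p)"
      "j * (a * p' - a' * p) = a * (j * p') - a' * (j * p)" by (simp_all add: algebra_simps)
    then show ?thesis unfolding e by (simp add: algebra_simps)
  qed
  define w k0 l0 where "w = q * a' - q' * a" and "k0 = q * p' - q' * p" and "l0 = a * p' - a' * p"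
  have w: "w \<noteq> 0" using assms by (simp add: w_def)
  have e: "j * k0 = k * w" "j * l0 = l * w" "j' * k0 = k' * w" "j' * l0 = l' * w"
    using *[OF assms(6,7)] *[OF assms(8,9)] by (auto simp: w_def k0_def l0_def)
  have "w * (j * k') = j * (j' * k0)" unfolding e by simp
  also have "\<dots> = w * (j' * k)" using e(1) by simp
  finally have 1: "j * k' = j' * k" using w by simp
  have "w * (j * l') = j * (j' * l0)" unfolding e by simp
  also have "\<dots> = w * (j' * l)" using e(2) by simp
  finally have 2: "j * l' = j' * l" using w by simp
  show ?thesis using primitive_parallel_eq assms 1 2 by blast
qed

section \<open>Coplanarity of nearby triples, and triples with a common abscissa\<close>

locale near_curve =
  fixes f g :: "real \<Rightarrow> real" and l L A B Q d :: real
  assumes pinched: "pinched f g l L" and AB: "A \<le> B" and Q: "1 \<le> Q" and d: "0 < d"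
begin

abbreviation P where "P \<equiv> prim_triples f A B Q d"

text \<open>Small enough for L c0^3 + 8 c0 < 1 in \<open>coplanar\<close> and for the bounds with
  1/16 in \<open>admissible\<close>.\<close>

definition c0 where "c0 = 1 / (16 * (1 + L))"
definition H where "H = d * Q\<^sup>2 + Q"
text \<open>Points within this distance of a given one are coplanar with it, and since the length is
  a constant over \<open>H\<close>, covering [A, B] takes only O(H) intervals of this
  length.\<close>

definition \<rho> where "\<rho> = c0 / H"

lemma lL: "0 < l" "l \<le> L" "0 < L"
  using pinched_pos[OF pinched] pinched_le[OF pinched] by auto

lemma c0: "0 < c0" "c0 \<le> 1 / 16" "c0 * L \<le> 1 / 16"
  using lL by (auto simp: c0_def field_simps)

lemma H: "1 \<le> H" "Q \<le> H" "d * Q\<^sup>2 \<le> H"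
proof -
  have "0 \<le> d * Q\<^sup>2" using d by simp
  then show "1 \<le> H" "Q \<le> H" "d * Q\<^sup>2 \<le> H" using Q by (auto simp: H_def)
qed

lemma \<rho>: "0 < \<rho>" "Q * \<rho> \<le> c0" "d * Q\<^sup>2 * \<rho> \<le> c0"
proof -
  show pos: "0 < \<rho>" using c0 H by (simp add: \<rho>_def)
  have "H * \<rho> = c0" using H by (simp add: \<rho>_def)
  then show "Q * \<rho> \<le> c0" "d * Q\<^sup>2 * \<rho> \<le> c0"
    using mult_right_mono[OF H(2), of \<rho>] mult_right_mono[OF H(3), of \<rho>] pos by auto
qed

lemma P_D:
  assumes "(q, a, p) \<in> P"
  shows "0 < q" "Q / 2 < of_int q" "of_int q \<le> Q" "A \<le> of_int a / of_int q" "of_int a / of_int q \<le> B"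
    "\<bar>of_int q * f (of_int a / of_int q) - of_int p\<bar> \<le> d" "primitive (q, a, p)"
proof -
  show q: "0 < q" "Q / 2 < of_int q" "of_int q \<le> Q" using assms Q
    by (auto simp: prim_triples_def near_triples_def)
  show "A \<le> of_int a / of_int q" "of_int a / of_int q \<le> B"
    "\<bar>of_int q * f (of_int a / of_int q) - of_int p\<bar> \<le> d" "primitive (q, a, p)" using assms q(1)
    by (auto simp: prim_triples_def near_triples_def pos_le_divide_eq pos_divide_le_eq)
qed

lemma P_error:
  assumes "(q, a, p) \<in> P"
  shows "\<bar>of_int p / of_int q - f (of_int a / of_int q)\<bar> \<le> 2 * d / Q"
proof -
  note D = P_D[OF assms]
  have "of_int p / of_int q - f (of_int a / of_int q) =
    - ((of_int q * f (of_int a / of_int q) - of_int p) / of_int q)"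
    using D(1) by (simp add: diff_divide_distrib)
  then have "\<bar>of_int p / of_int q - f (of_int a / of_int q)\<bar> =
    \<bar>of_int q * f (of_int a / of_int q) - of_int p\<bar> / of_int q"
    using D(1) by (simp add: abs_divide)
  also have "\<dots> \<le> d / of_int q" using D(1,6) by (intro divide_right_mono) auto
  also have "\<dots> \<le> d / (Q / 2)" using D(2) d Q by (intro divide_left_mono) auto
  finally show ?thesis by (simp add: mult.commute)
qed

lemma abscissa_eq_iff:
  assumes "(q, a, p) \<in> P" "(q', a', p') \<in> P"
  shows "abscissa (q, a, p) = abscissa (q', a', p') \<longleftrightarrow> q * a' = q' * a"
proof -
  have "abscissa (q, a, p) = abscissa (q', a', p') \<longleftrightarrow>
    (of_int a * of_int q' :: real) = of_int a' * of_int q"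
    using P_D(1)[OF assms(1)] P_D(1)[OF assms(2)] by (simp add: abscissa_def frac_eq_eq)
  also have "\<dots> \<longleftrightarrow> a * q' = a' * q" by (metis of_int_eq_iff of_int_mult)
  finally show ?thesis by (auto simp: mult.commute)
qed

text \<open>Up to sign the determinant is q1 q2 q3 times twice the area of the triangle with
  vertices (a/q, p/q). The triangle hugs the line of slope \<open>g x1\<close> through its first
  vertex, so the determinant is an integer of absolute value less than 1.\<close>

lemma coplanar:
  assumes v: "v1 \<in> P" "v2 \<in> P" "v3 \<in> P"
    and near: "\<bar>abscissa v2 - abscissa v1\<bar> \<le> \<rho>" "\<bar>abscissa v3 - abscissa v1\<bar> \<le> \<rho>"
  shows "det3 v1 v2 v3 = 0"
proof -
  obtain q1 a1 p1 q2 a2 p2 q3 a3 p3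
    where vs: "v1 = (q1, a1, p1)" "v2 = (q2, a2, p2)" "v3 = (q3, a3, p3)"
    by (cases v1, cases v2, cases v3)
  note v = v[unfolded vs]
  define x1 x2 x3 y1 y2 y3 :: real where xy: "x1 = a1 / q1" "x2 = a2 / q2" "x3 = a3 / q3"
    "y1 = p1 / q1" "y2 = p2 / q2" "y3 = p3 / q3"
  have q: "0 < q1" "0 < q2" "0 < q3" "q1 \<le> Q" "q2 \<le> Q" "q3 \<le> Q"
    using P_D(1,3)[OF v(1)] P_D(1,3)[OF v(2)] P_D(1,3)[OF v(3)] by auto
  have det: "real_of_int (det3 v1 v2 v3) =
    of_int q1 * of_int q2 * of_int q3 * ((x2 - x1) * (y3 - y1) - (x3 - x1) * (y2 - y1))"
  proof -
    have "of_int a1 = x1 * of_int q1" "of_int a2 = x2 * of_int q2" "of_int a3 = x3 * of_int q3"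
      "of_int p1 = y1 * of_int q1" "of_int p2 = y2 * of_int q2" "of_int p3 = y3 * of_int q3"
      using q by (simp_all add: xy)
    then show ?thesis by (simp add: vs det3_def algebra_simps)
  qed
  \<comment> \<open>The curvature term over a distance \<open>\<rho>\<close>, plus a vertical error
    of 2d/Q at each of the two points.\<close>
  define M where "M = L / 2 * \<rho>\<^sup>2 + 4 * d / Q"
  have dev: "\<bar>y - y1 - g x1 * (x - x1)\<bar> \<le> M"
    if "\<bar>y - f x\<bar> \<le> 2 * d / Q" "\<bar>x - x1\<bar> \<le> \<rho>" for x y
  proof -
    have "\<bar>x - x1\<bar>\<^sup>2 \<le> \<rho>\<^sup>2" using that by (intro power_mono) auto
    then have "0 \<le> l / 2 * (x - x1)\<^sup>2" "L / 2 * (x - x1)\<^sup>2 \<le> L / 2 * \<rho>\<^sup>2"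
      using lL by (auto intro!: mult_left_mono)
    moreover have "\<bar>y1 - f x1\<bar> \<le> 2 * d / Q" using P_error[OF v(1)] by (simp add: xy)
    ultimately show ?thesis
      using pinched_lower[OF pinched, of x1 x] pinched_upper[OF pinched, of x x1] that
      unfolding M_def by linarith
  qed
  have near': "\<bar>x2 - x1\<bar> \<le> \<rho>" "\<bar>x3 - x1\<bar> \<le> \<rho>" using near by (auto simp: vs abscissa_def xy)
  have M: "\<bar>y3 - y1 - g x1 * (x3 - x1)\<bar> \<le> M" "\<bar>y2 - y1 - g x1 * (x2 - x1)\<bar> \<le> M"
    using dev[OF _ near'(1)] dev[OF _ near'(2)] P_error[OF v(2)] P_error[OF v(3)]
    by (auto simp: xy)
  have M0: "0 \<le> M" using M by linarith
  \<comment> \<open>Shearing along the slope \<open>g x1\<close> leaves the 2x2 determinant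
    unchanged.\<close>
  have "(x2 - x1) * (y3 - y1) - (x3 - x1) * (y2 - y1) =
    (x2 - x1) * (y3 - y1 - g x1 * (x3 - x1)) - (x3 - x1) * (y2 - y1 - g x1 * (x2 - x1))"
    by (simp add: algebra_simps)
  also have "\<bar>\<dots>\<bar> \<le> \<bar>x2 - x1\<bar> * \<bar>y3 - y1 - g x1 * (x3 - x1)\<bar> +
      \<bar>x3 - x1\<bar> * \<bar>y2 - y1 - g x1 * (x2 - x1)\<bar>"
    unfolding abs_mult[symmetric] by (rule abs_triangle_ineq4)
  also have "\<dots> \<le> \<rho> * M + \<rho> * M"
    using near' M \<rho>(1) M0 by (intro add_mono mult_mono) auto
  finally have *: "\<bar>(x2 - x1) * (y3 - y1) - (x3 - x1) * (y2 - y1)\<bar> \<le> 2 * \<rho> * M"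
    by (simp add: mult_ac)
  have "\<bar>real_of_int (det3 v1 v2 v3)\<bar> \<le> Q * Q * Q * (2 * \<rho> * M)"
    unfolding det abs_mult using q * by (intro mult_mono) auto
  also have "\<dots> = L * (Q * \<rho>) ^ 3 + 8 * (d * Q\<^sup>2 * \<rho>)"
  proof -
    have "Q * M = L / 2 * (Q * \<rho>\<^sup>2) + 4 * d" using Q by (simp add: M_def algebra_simps)
    moreover have "Q * Q * Q * (2 * \<rho> * M) = 2 * Q * Q * \<rho> * (Q * M)" by simp
    ultimately show ?thesis by (simp add: algebra_simps power2_eq_square power3_eq_cube)
  qed
  also have "\<dots> \<le> L * c0 ^ 3 + 8 * c0"
    using lL \<rho> Q by (intro add_mono mult_left_mono power_mono) auto
  also have "L * c0 ^ 3 \<le> L * c0"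
  proof -
    have "c0 ^ 3 \<le> c0 ^ 1" using c0 by (intro power_decreasing) auto
    then show ?thesis using lL by simp
  qed
  finally have "\<bar>real_of_int (det3 v1 v2 v3)\<bar> < 1" using c0 by (simp add: mult.commute)
  then show ?thesis by linarith
qed

lemma finite_P: "finite P"
proof (rule finite_subset)
  let ?T = "SIGMA q:{1..\<lfloor>Q\<rfloor>}. SIGMA a:{\<lfloor>A * of_int q\<rfloor>..\<lceil>B * of_int q\<rceil>}.
    {\<lfloor>of_int q * f (of_int a / of_int q) - d\<rfloor>..\<lceil>of_int q * f (of_int a / of_int q) + d\<rceil>}"
  show "P \<subseteq> ?T"
  proof
    fix v assume v: "v \<in> P"
    obtain q a p where [simp]: "v = (q, a, p)" by (cases v)
    have "A * of_int q \<le> of_int a" "of_int a \<le> B * of_int q"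
      using v by (auto simp: prim_triples_def near_triples_def)
    then have "a \<in> {\<lfloor>A * of_int q\<rfloor>..\<lceil>B * of_int q\<rceil>}"
      unfolding atLeastAtMost_iff by linarith
    moreover have "q \<in> {1..\<lfloor>Q\<rfloor>}" using P_D(1,3)[of q a p] v by (simp add: le_floor_iff)
    moreover have "p \<in> {\<lfloor>of_int q * f (of_int a / of_int q) - d\<rfloor>..
        \<lceil>of_int q * f (of_int a / of_int q) + d\<rceil>}"
      using P_D(6)[of q a p] v unfolding atLeastAtMost_iff by simp linarith
    ultimately show "v \<in> ?T" by simp
  qed
  show "finite ?T" by auto
qed

text \<open>Primitive triples with a common abscissa of denominator \<open>m\<close> have ordinates \<open>p/q\<close> that are
  separated by \<open>m / Q\<^sup>2\<close>.\<close>

lemma distinct_abscissae: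
  obtains S where "S \<subseteq> P" "inj_on abscissa S"
    "real (card P) \<le> real (card S) + 4 * (B - A + 1) * (d * Q\<^sup>2)"
proof -
  let ?X = "abscissa ` P"
  \<comment> \<open>The denominator of an abscissa in lowest terms governs how many triples share
    it.\<close>
  have "\<exists>b n::int. 1 \<le> n \<and> of_int n \<le> Q \<and> coprime b n \<and> x = of_int b / of_int n"
    if x: "x \<in> ?X" for x
  proof -
    obtain q a p where v: "(q, a, p) \<in> P" "x = of_int a / of_int q"
      using x by (fastforce simp: abscissa_def)
    have q: "0 < q" "of_int q \<le> Q" using P_D[OF v(1)] by auto
    define G where "G = gcd a q"
    define n b where "n = q div G" and "b = a div G"
    have "0 < G" using q by (simp add: G_def)
    have eq: "n * G = q" "b * G = a" by (auto simp: n_def b_def G_def)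
    have "coprime b n" unfolding b_def n_def G_def using q by (intro div_gcd_coprime) auto
    moreover have "0 < n * G" using eq q by simp
    then have "1 \<le> n" using \<open>0 < G\<close> by (simp add: zero_less_mult_iff)
    moreover have "n \<le> q" using q eq by (metis dvd_triv_left zdvd_imp_le)
    moreover have "x = of_int b / of_int n"
      unfolding v(2) eq[symmetric] using \<open>0 < G\<close> by simp
    ultimately show ?thesis using q by (intro exI[of _ b] exI[of _ n]) linarith
  qed
  then obtain b n :: "real \<Rightarrow> int" where bn: "\<And>x. x \<in> ?X \<Longrightarrow>
      1 \<le> n x \<and> of_int (n x) \<le> Q \<and> coprime (b x) (n x) \<and> x = of_int (b x) / of_int (n x)"
    by metis
  have fibre: "real (card {v \<in> P. abscissa v = x}) \<le> 1 + 4 * d * Q / of_int (n x)"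
    if x: "x \<in> ?X" for x
  proof -
    have n: "1 \<le> n x" "coprime (b x) (n x)" "x = of_int (b x) / of_int (n x)"
      using bn[OF x] by auto
    let ?y = "\<lambda>(q::int, a::int, p::int). real_of_int p / real_of_int q"
    have "real (card {v \<in> P. abscissa v = x}) \<le> (4 * d / Q) / (of_int (n x) / Q\<^sup>2) + 1"
    proof (rule card_spaced_le[where x = ?y])
      show "finite {v \<in> P. abscissa v = x}" using finite_P by simp
      show "0 < of_int (n x) / Q\<^sup>2" using n Q by simp
      show "0 \<le> 4 * d / Q" using d Q by simp
    next
      fix v w assume vw: "v \<in> {v \<in> P. abscissa v = x}" "w \<in> {v \<in> P. abscissa v = x}" "v \<noteq> w"
      obtain q a p q' a' p' where v: "v = (q, a, p)" and w: "w = (q', a', p')"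
        by (cases v, cases w)
      have in_P: "(q, a, p) \<in> P" "(q', a', p') \<in> P" using vw v w by auto
      have q: "0 < q" "of_int q \<le> Q" "0 < q'" "of_int q' \<le> Q"
        using P_D[OF in_P(1)] P_D[OF in_P(2)] by auto
      have "n x dvd q" if "of_int a / of_int q = x" "0 < q" for a q :: int
      proof -
        have "of_int (a * n x) = (of_int (b x * q) :: real)" using that n by (simp add: field_simps)
        then have "n x dvd b x * q" by (metis dvd_triv_right of_int_eq_iff)
        then show ?thesis using n(2) by (simp add: coprime_commute coprime_dvd_mult_right_iff)
      qed
      then have "n x dvd q" "n x dvd q'" using vw v w q by (auto simp: abscissa_def)
      \<comment> \<open>Over the denominator q q', the difference of the two ordinates has this
        numerator, which is a nonzero multiple of \<open>n x\<close> because distinct primitive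
        triples are not parallel.\<close>
      then have "n x dvd p * q' - p' * q" by simp
      moreover have "p * q' - p' * q \<noteq> 0"
      proof
        assume "p * q' - p' * q = 0"
        moreover have "q * a' = q' * a" using abscissa_eq_iff[OF in_P] vw v w by simp
        ultimately have "(q, a, p) = (q', a', p')"
          using primitive_parallel_eq P_D(7)[OF in_P(1)] P_D(7)[OF in_P(2)] q
          by (simp add: mult.commute)
        then show False using vw v w by simp
      qed
      ultimately have "n x \<le> \<bar>p * q' - p' * q\<bar>" by (simp add: zdvd_imp_le)
      then have "of_int (n x) \<le> \<bar>of_int p * of_int q' - of_int p' * of_int q :: real\<bar>"
        by (metis of_int_abs of_int_diff of_int_le_iff of_int_mult)
      moreover have "of_int q * of_int q' \<le> Q\<^sup>2" unfolding power2_eq_square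
        using q Q by (intro mult_mono) auto
      ultimately have "of_int (n x) / Q\<^sup>2 \<le>
        \<bar>of_int p * of_int q' - of_int p' * of_int q :: real\<bar> / (of_int q * of_int q')"
        using q by (intro frac_le) auto
      also have "\<dots> = \<bar>of_int p / of_int q - of_int p' / of_int q'\<bar>"
        using q by (simp add: diff_frac_eq abs_divide)
      finally show "of_int (n x) / Q\<^sup>2 \<le> \<bar>?y v - ?y w\<bar>" by (simp add: v w)
    next
      fix v w assume vw: "v \<in> {v \<in> P. abscissa v = x}" "w \<in> {v \<in> P. abscissa v = x}"
      have "\<bar>?y u - f x\<bar> \<le> 2 * d / Q" if "u \<in> P" "abscissa u = x" for u
        using that P_error by (cases u) (auto simp: abscissa_def)
      from this[of v] this[of w] vw show "\<bar>?y v - ?y w\<bar> \<le> 4 * d / Q" by auto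
    qed
    also have "\<dots> = 1 + 4 * d * Q / of_int (n x)"
      using Q n by (simp add: field_simps power2_eq_square)
    finally show ?thesis .
  qed
  have fX: "finite ?X" using finite_P by simp
  \<comment> \<open>Distinct abscissae give distinct pairs (n, b). A denominator \<open>m\<close>
    admits at most (B - A) m + 1 numerators; after division by \<open>m\<close> each of the at most
    \<open>Q\<close> denominators costs at most B - A + 1.\<close>
  have recip: "(\<Sum>x\<in>?X. 1 / of_int (n x)) \<le> (B - A + 1) * Q"
  proof -
    let ?T = "SIGMA m:{1..\<lfloor>Q\<rfloor>}. {k::int. A * of_int m \<le> of_int k \<and> of_int k \<le> B * of_int m}"
    have fin: "finite {k::int. A * of_int m \<le> of_int k \<and> of_int k \<le> B * of_int m}"
      and crd: "real (card {k::int. A * of_int m \<le> of_int k \<and> of_int k \<le> B * of_int m})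
        \<le> B * of_int m - A * of_int m + 1" if "m \<in> {1..\<lfloor>Q\<rfloor>}" for m
      using card_int_interval_le[of "A * of_int m" "B * of_int m"] AB that
      by (auto intro: mult_right_mono)
    have "(\<Sum>x\<in>?X. 1 / of_int (n x)) = (\<Sum>c\<in>(\<lambda>x. (n x, b x)) ` ?X. 1 / real_of_int (fst c))"
    proof -
      have inj: "inj_on (\<lambda>x. (n x, b x)) ?X" using bn by (intro inj_onI) (metis Pair_inject)
      show ?thesis by (simp add: sum.reindex[OF inj] o_def)
    qed
    also have "\<dots> \<le> (\<Sum>c\<in>?T. 1 / real_of_int (fst c))"
    proof (rule sum_mono2)
      show "finite ?T" using fin by auto
      show "(\<lambda>x. (n x, b x)) ` ?X \<subseteq> ?T"
      proof
        fix c assume "c \<in> (\<lambda>x. (n x, b x)) ` ?X"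
        then obtain x where x: "x \<in> ?X" "c = (n x, b x)" by blast
        note bnx = bn[OF x(1)]
        have "A \<le> x \<and> x \<le> B" using x(1) P_D(4,5) by (auto simp: abscissa_def)
        moreover have "x * of_int (n x) = of_int (b x)"
          using bnx nonzero_eq_divide_eq[of "of_int (n x)" x "of_int (b x)"] by simp
        ultimately have "A * of_int (n x) \<le> of_int (b x) \<and> of_int (b x) \<le> B * of_int (n x)"
          using bnx by (smt (verit) mult_right_mono of_int_1_le_iff)
        then show "c \<in> ?T" using bnx by (simp add: x le_floor_iff)
      qed
    qed auto
    also have "\<dots> = (\<Sum>m\<in>{1..\<lfloor>Q\<rfloor>}. \<Sum>k\<in>{k::int. A * of_int m \<le> of_int k \<and> of_int k \<le> B * of_int m}.
        1 / real_of_int m)"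
      using fin by (subst sum.Sigma) (auto simp: case_prod_beta)
    also have "\<dots> \<le> (\<Sum>m\<in>{1..\<lfloor>Q\<rfloor>}. B - A + 1)"
    proof (rule sum_mono)
      fix m assume m: "m \<in> {1..\<lfloor>Q\<rfloor>}"
      have "(B * of_int m - A * of_int m + 1) * (1 / real_of_int m) \<le> B - A + 1"
        using m by (simp add: field_simps)
      moreover have "real (card {k::int. A * of_int m \<le> of_int k \<and> of_int k \<le> B * of_int m}) *
        (1 / real_of_int m) \<le> (B * of_int m - A * of_int m + 1) * (1 / real_of_int m)"
        using crd[OF m] m by (intro mult_right_mono) auto
      ultimately show "(\<Sum>k\<in>{k::int. A * of_int m \<le> of_int k \<and> of_int k \<le> B * of_int m}.
        1 / real_of_int m) \<le> B - A + 1" by simp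
    qed
    also have "\<dots> = of_int \<lfloor>Q\<rfloor> * (B - A + 1)" using Q by simp
    also have "\<dots> \<le> Q * (B - A + 1)" using AB by (intro mult_right_mono) auto
    finally show ?thesis by (simp add: mult.commute)
  qed
  have "(\<Union>x\<in>?X. {v \<in> P. abscissa v = x}) = P" by auto
  then have "card P \<le> (\<Sum>x\<in>?X. card {v \<in> P. abscissa v = x})"
    using card_UN_le[OF fX, of "\<lambda>x. {v \<in> P. abscissa v = x}"] by simp
  then have "real (card P) \<le> real (\<Sum>x\<in>?X. card {v \<in> P. abscissa v = x})"
    by (rule of_nat_mono)
  also have "\<dots> = (\<Sum>x\<in>?X. real (card {v \<in> P. abscissa v = x}))" by simp
  also have "\<dots> \<le> (\<Sum>x\<in>?X. 1 + 4 * d * Q / of_int (n x))" by (intro sum_mono fibre)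
  also have "\<dots> = real (card ?X) + 4 * d * Q * (\<Sum>x\<in>?X. 1 / of_int (n x))"
    by (simp add: sum.distrib sum_distrib_left)
  also have "\<dots> \<le> real (card ?X) + 4 * d * Q * ((B - A + 1) * Q)"
    using recip d Q by (intro add_left_mono mult_left_mono) auto
  finally have "real (card P) \<le> real (card ?X) + 4 * (B - A + 1) * (d * Q\<^sup>2)"
    by (simp add: power2_eq_square mult_ac)
  \<comment> \<open>\<open>S\<close> keeps one triple over each abscissa.\<close>
  moreover define S where "S = inv_into P abscissa ` ?X"
  have "S \<subseteq> P" unfolding S_def by (intro image_subsetI inv_into_into)
  moreover have "inj_on abscissa S" unfolding S_def
    by (intro inj_onI) (metis (no_types, lifting) f_inv_into_f imageE)
  moreover have "card S = card ?X" unfolding S_def by (intro card_image inj_on_inv_into) simp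
  ultimately show ?thesis using that by simp
qed

end

section \<open>Points on a plane\<close>

context near_curve
begin

text \<open>\<open>j\<close> times the vertical gap between the curve and the line of the
  plane.\<close>

definition F :: "int \<times> int \<times> int \<Rightarrow> real \<Rightarrow> real"
  where "F = (\<lambda>(j, k, n) x. of_int j * f x - of_int k * x + of_int n)"

text \<open>For positive \<open>j\<close>, the minimum point of \<open>F\<close>, where the curve is
  parallel to the line.\<close>

definition \<zeta> :: "int \<times> int \<times> int \<Rightarrow> real"
  where "\<zeta> = (\<lambda>(j, k, n). conj_slope g (of_int k / of_int j))"

text \<open>The bound on j d keeps the points of the plane within half of the strip |F| \<le> 1/(4Q)
  and makes the strip detect the plane. The bound on \<open>j\<close> places every dyadic block of
  such normals below \<open>Q\<close>, so that the dual problem is in the sparse range.\<close>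

definition admissible :: "int \<times> int \<times> int \<Rightarrow> bool"
  where "admissible c \<longleftrightarrow> primitive c \<and> 1 \<le> fst c \<and>
    of_int (fst c) * d \<le> 1 / 16 \<and> of_int (fst c) \<le> Q / 16"

lemma admissible_D:
  assumes "admissible (j, k, n)"
  shows "primitive (j, k, n)" "1 \<le> j" "of_int j * d \<le> 1 / 16" "of_int j \<le> Q / 16"
  using assms by (auto simp: admissible_def)

lemma \<zeta>_slope:
  assumes "1 \<le> j"
  shows "of_int j * g (\<zeta> (j, k, n)) = of_int k"
  using assms slope_conj_slope[OF pinched] by (simp add: \<zeta>_def)

text \<open>Writing the slope of \<open>F\<close> at \<open>x\<close> relative to the minimum point
  displays its sign on either side.\<close>

lemma F_lower:
  assumes "1 \<le> j"
  shows "F (j, k, n) x + of_int j * (g x - g (\<zeta> (j, k, n))) * (y - x) +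
    of_int j * l / 2 * (y - x)\<^sup>2 \<le> F (j, k, n) y"
proof -
  have "of_int j * (f x + g x * (y - x) + l / 2 * (y - x)\<^sup>2) \<le> of_int j * f y"
    using assms by (intro mult_left_mono pinched_lower[OF pinched]) auto
  then show ?thesis
    by (simp add: F_def \<zeta>_slope[OF assms, of k n, symmetric] algebra_simps)
qed

text \<open>Away from the minimum the linear term of \<open>F_lower\<close> is nonnegative, which
  leaves the quadratic one.\<close>

lemma F_one_side:
  assumes "1 \<le> j" "(x \<le> y \<and> y \<le> \<zeta> (j, k, n)) \<or> (\<zeta> (j, k, n) \<le> y \<and> y \<le> x)"
  shows "F (j, k, n) y + of_int j * l / 2 * (x - y)\<^sup>2 \<le> F (j, k, n) x"
proof -
  have "0 \<le> (g y - g (\<zeta> (j, k, n))) * (x - y)"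
    using assms(2) pinched_slope_mono[OF pinched]
    by (smt (verit) mult_nonneg_nonneg mult_nonpos_nonpos)
  then have "0 \<le> of_int j * ((g y - g (\<zeta> (j, k, n))) * (x - y))" using assms(1) by simp
  then show ?thesis using F_lower[OF assms(1), of k n y x] by (simp add: mult.assoc)
qed

lemma F_one_side_le:
  assumes "1 \<le> j" "(x \<le> y \<and> y \<le> \<zeta> (j, k, n)) \<or> (\<zeta> (j, k, n) \<le> y \<and> y \<le> x)"
  shows "F (j, k, n) y \<le> F (j, k, n) x"
proof -
  have "0 \<le> of_int j * l / 2 * (x - y)\<^sup>2" using assms(1) lL by simp
  then show ?thesis using F_one_side[OF assms] by linarith
qed

lemma abscissa_range: "v \<in> P \<Longrightarrow> A \<le> abscissa v \<and> abscissa v \<le> B"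
  using P_D(4,5) by (cases v) (auto simp: abscissa_def)

text \<open>The ordinate p/q lies on the line of the plane, so \<open>F\<close> is, up to sign,
  \<open>j\<close> times the vertical error of the point.\<close>

lemma F_at_point:
  assumes "v \<in> P" "on_plane (j, k, n) v" "1 \<le> j"
  shows "\<bar>F (j, k, n) (abscissa v)\<bar> \<le> 2 * of_int j * d / Q"
proof -
  obtain q a p where v: "v = (q, a, p)" by (cases v)
  have q: "0 < q" using assms P_D v by auto
  have "of_int (j * p) = (of_int (k * a - n * q) :: real)"
    using assms(2) by (simp only: on_plane_def v case_prod_conv)
  then have "of_int j * (of_int p / of_int q) = of_int k * (of_int a / of_int q) - (of_int n :: real)"
    using q by (simp add: field_simps)
  then have "F (j, k, n) (abscissa v) =
    - (of_int j * (of_int p / of_int q - f (of_int a / of_int q)))"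
    by (simp add: F_def v abscissa_def right_diff_distrib)
  then have "\<bar>F (j, k, n) (abscissa v)\<bar> =
    of_int j * \<bar>of_int p / of_int q - f (of_int a / of_int q)\<bar>"
    using assms(3) by (simp add: abs_mult)
  also have "\<dots> \<le> of_int j * (2 * d / Q)"
    using assms P_error[of q a p] v by (intro mult_left_mono) auto
  also have "\<dots> = 2 * of_int j * d / Q" by simp
  finally show ?thesis .
qed

text \<open>The integer \<open>j p - k a + n q\<close> is less than \<open>1\<close> in absolute value.\<close>

lemma on_plane_if_F_small:
  assumes c: "admissible (j, k, n)" and v: "v \<in> P"
    and F: "\<bar>F (j, k, n) (abscissa v)\<bar> \<le> 1 / (4 * Q)"
  shows "on_plane (j, k, n) v"
proof -
  obtain q a p where v': "v = (q, a, p)" by (cases v)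
  have vP: "(q, a, p) \<in> P" using v v' by simp
  note D = P_D[OF vP] and j = admissible_D[OF c]
  define x :: real where "x = of_int a / of_int q"
  have a: "of_int a = of_int q * x" using D(1) by (simp add: x_def)
  have "of_int (j * p - k * a + n * q) =
    of_int q * F (j, k, n) x - of_int j * (of_int q * f x - of_int p)"
    by (simp add: F_def a algebra_simps)
  also have "\<bar>\<dots>\<bar> \<le> \<bar>of_int q * F (j, k, n) x\<bar> + \<bar>of_int j * (of_int q * f x - of_int p)\<bar>"
    by (rule abs_triangle_ineq4)
  also have "\<dots> \<le> Q * (1 / (4 * Q)) + of_int j * d"
    unfolding abs_mult using D j F
    by (intro add_mono mult_mono) (auto simp: x_def v' abscissa_def)
  also have "\<dots> < 1" using Q j by simp
  finally have "\<bar>real_of_int (j * p - k * a + n * q)\<bar> < 1" .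
  then have "j * p - k * a + n * q = 0" by linarith
  then show ?thesis by (simp add: on_plane_def v')
qed

text \<open>Up to sign the difference is (q a' - q' a)/(q q'), with a nonzero multiple of
  \<open>j\<close> on top by \<open>plane_dvd\<close> and at most Q^2 below.\<close>

lemma on_plane_spacing:
  assumes "v \<in> P" "w \<in> P" "abscissa v \<noteq> abscissa w" "on_plane (j, k, n) v" "on_plane (j, k, n) w"
    and "primitive (j, k, n)"
  shows "of_int j / Q\<^sup>2 \<le> \<bar>abscissa v - abscissa w\<bar>"
proof -
  obtain q a p q' a' p' where v: "v = (q, a, p)" and w: "w = (q', a', p')" by (cases v, cases w)
  have in_P: "(q, a, p) \<in> P" "(q', a', p') \<in> P" using assms v w by auto
  note D = P_D(1,3)[OF in_P(1)] P_D(1,3)[OF in_P(2)]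
  have "q * a' - q' * a \<noteq> 0" using assms(3) abscissa_eq_iff[OF in_P] v w by simp
  moreover have "j dvd q * a' - q' * a" using plane_dvd[OF assms(6)] assms(4,5) v w by blast
  ultimately have "j \<le> \<bar>q * a' - q' * a\<bar>" by (intro zdvd_imp_le) auto
  then have "of_int j \<le> \<bar>of_int q * of_int a' - of_int q' * of_int a :: real\<bar>"
    by (metis of_int_abs of_int_diff of_int_le_iff of_int_mult)
  moreover have "of_int q * of_int q' \<le> Q\<^sup>2" unfolding power2_eq_square
    using D Q by (intro mult_mono) auto
  ultimately have "of_int j / Q\<^sup>2 \<le>
    \<bar>of_int q * of_int a' - of_int q' * of_int a :: real\<bar> / (of_int q * of_int q')"
    using D by (intro frac_le) auto
  also have "\<dots> = \<bar>of_int a' / of_int q' - of_int a / of_int q\<bar>"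
    using D by (simp add: diff_frac_eq abs_divide mult.commute)
  finally show ?thesis by (simp add: v w abscissa_def abs_minus_commute)
qed

lemma plane_card_le:
  assumes "1 \<le> j" "primitive (j, k, n)" "T \<subseteq> P" "inj_on abscissa T" "0 \<le> R"
    and "\<And>v. v \<in> T \<Longrightarrow> on_plane (j, k, n) v"
    and "\<And>v w. v \<in> T \<Longrightarrow> w \<in> T \<Longrightarrow> \<bar>abscissa v - abscissa w\<bar> \<le> R"
  shows "real (card T) \<le> 1 + Q\<^sup>2 * R / of_int j"
proof -
  have "real (card T) \<le> R / (of_int j / Q\<^sup>2) + 1"
  proof (rule card_spaced_le)
    show "finite T" using finite_P assms(3) finite_subset by blast
    show "0 < of_int j / Q\<^sup>2" using assms(1) Q by simp
    fix v w assume "v \<in> T" "w \<in> T" "v \<noteq> w"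
    then show "of_int j / Q\<^sup>2 \<le> \<bar>abscissa v - abscissa w\<bar>"
      using assms by (intro on_plane_spacing[where k = k and n = n]) (auto simp: inj_on_def)
  qed (use assms in auto)
  then show ?thesis by (simp add: mult.commute)
qed

end

section \<open>Points of a plane on either side of the minimum\<close>

locale separated_points = near_curve +
  fixes S
  assumes S: "S \<subseteq> P" and inj: "inj_on abscissa S"
begin

lemma finite_S: "finite S"
  using finite_P S finite_subset by blast

text \<open>\<open>s\<close> is 1 for the points to the right of the minimum and -1 for those to the
  left; on each side \<open>F\<close> is monotone. A point at the minimum belongs to both.\<close>

definition side :: "real \<Rightarrow> int \<times> int \<times> int \<Rightarrow> (int \<times> int \<times> int) set"
  where "side s c = {v \<in> S. on_plane c v \<and> 0 \<le> s * (abscissa v - \<zeta> c)}"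

lemma side_subset: "side s c \<subseteq> P" "inj_on abscissa (side s c)"
  using S inj by (auto simp: side_def intro: inj_on_subset)

lemma card_on_plane:
  "card {v \<in> S. on_plane c v} \<le> card (side 1 c) + card (side (-1) c)"
proof -
  have "{v \<in> S. on_plane c v} \<subseteq> side 1 c \<union> side (-1) c"
    by (auto simp: side_def)
  then have "card {v \<in> S. on_plane c v} \<le> card (side 1 c \<union> side (-1) c)"
    using finite_S by (intro card_mono) (auto simp: side_def)
  then show ?thesis using card_Un_le order_trans by blast
qed

text \<open>\<open>F\<close> varies by at most \<open>2 * \<epsilon>\<close> between the two points
  but grows quadratically away from the minimum.\<close>

lemma side_width:
  assumes "1 \<le> j" "s = 1 \<or> s = -1" "0 \<le> s * (x - \<zeta> (j, k, n))" "0 \<le> s * (y - \<zeta> (j, k, n))"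
    and "\<bar>F (j, k, n) x\<bar> \<le> \<epsilon>" "\<bar>F (j, k, n) y\<bar> \<le> \<epsilon>"
  shows "of_int j * l * (x - y)\<^sup>2 \<le> 4 * \<epsilon>"
proof -
  have "of_int j * l / 2 * (x - y)\<^sup>2 \<le> 2 * \<epsilon>"
  proof (cases "s * x \<le> s * y")
    case True
    then have "F (j, k, n) x + of_int j * l / 2 * (y - x)\<^sup>2 \<le> F (j, k, n) y"
      using assms(2-4) by (intro F_one_side[OF assms(1)]) auto
    then show ?thesis using assms(5,6) by (simp add: power2_commute)
  next
    case False
    then have "F (j, k, n) y + of_int j * l / 2 * (x - y)\<^sup>2 \<le> F (j, k, n) x"
      using assms(2-4) by (intro F_one_side[OF assms(1)]) auto
    then show ?thesis using assms(5,6) by simp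
  qed
  then show ?thesis by simp
qed

text \<open>In \<open>side_width\<close> with the error of \<open>F_at_point\<close> the factor
  \<open>j\<close> cancels, which bounds the width of a side. This serves the tangent
  planes.\<close>

lemma card_side_le:
  assumes c: "admissible (j, k, n)" and s: "s = 1 \<or> s = -1"
  shows "real (card (side s (j, k, n))) \<le> 1 + Q\<^sup>2 * sqrt (8 * d / (l * Q)) / of_int j"
proof (rule plane_card_le)
  note j = admissible_D[OF c]
  show "1 \<le> j" "primitive (j, k, n)" using j by auto
  show "side s (j, k, n) \<subseteq> P" "inj_on abscissa (side s (j, k, n))"
    by (fact side_subset)+
  fix v w assume vw: "v \<in> side s (j, k, n)" "w \<in> side s (j, k, n)"
  have "of_int j * l * (abscissa v - abscissa w)\<^sup>2 \<le> 4 * (2 * of_int j * d / Q)"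
    using vw S j by (intro side_width[OF j(2) s, of _ k n] F_at_point) (auto simp: side_def)
  then have "(abscissa v - abscissa w)\<^sup>2 \<le> 8 * d / (l * Q)"
    using j lL Q by (simp add: field_simps)
  then show "\<bar>abscissa v - abscissa w\<bar> \<le> sqrt (8 * d / (l * Q))"
    by (simp add: real_le_rsqrt)
qed (use d Q lL in \<open>auto simp: side_def\<close>)

text \<open>By convexity the strip \<open>\<bar>F\<bar> \<le> 1 / (4 Q)\<close> extends beyond the points of the plane, towards
  \<open>\<zeta>\<close>, by at least \<open>1 / (32 j d)\<close> times their spread.\<close>

lemma transversal_side:
  assumes c: "admissible (j, k, n)" and s: "s = 1 \<or> s = -1"
    and m: "F (j, k, n) (\<zeta> (j, k, n)) < - 1 / (4 * Q)" and ne: "side s (j, k, n) \<noteq> {}"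
  obtains \<alpha> \<beta> where "A - 1 / sqrt l \<le> \<alpha>" "\<alpha> \<le> \<beta>" "\<beta> \<le> B + 1 / sqrt l"
    "real (card (side s (j, k, n))) \<le> 1 + 32 * (d * Q\<^sup>2) * (\<beta> - \<alpha>)"
    "\<And>x. \<alpha> \<le> x \<Longrightarrow> x \<le> \<beta> \<Longrightarrow> \<bar>F (j, k, n) x\<bar> \<le> 1 / (4 * Q)"
    "\<And>v. v \<in> side s (j, k, n) \<Longrightarrow> \<alpha> \<le> abscissa v \<and> abscissa v \<le> \<beta>"
proof -
  note j = admissible_D[OF c]
  let ?F = "F (j, k, n)" and ?z = "\<zeta> (j, k, n)" and ?D = "side s (j, k, n)"
  \<comment> \<open>\<open>u\<close> is the distance from the minimum towards the chosen side, so
    that left and right are treated at once.\<close>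
  define u where "u = (\<lambda>x. s * (x - ?z))"
  have ss: "s * s = 1" using s by auto
  define \<epsilon> where "\<epsilon> = 2 * of_int j * d / Q"
  have e: "0 \<le> \<epsilon>" "\<epsilon> \<le> 1 / (4 * Q)" using j d Q by (auto simp: \<epsilon>_def field_simps)
  have fin: "finite ?D" using finite_S by (simp add: side_def)
  have F_D: "\<bar>?F (abscissa v)\<bar> \<le> \<epsilon>" if "v \<in> ?D" for v
    unfolding \<epsilon>_def using that S j by (intro F_at_point) (auto simp: side_def)
  define u1 u2 where "u1 = Max (u ` abscissa ` ?D)" and "u2 = Min (u ` abscissa ` ?D)"
  have "u1 \<in> u ` abscissa ` ?D" "u2 \<in> u ` abscissa ` ?D"
    unfolding u1_def u2_def using fin ne by (auto intro!: Max_in Min_in simp del: image_image)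
  then obtain v1 v2 where v12: "v1 \<in> ?D" "u1 = u (abscissa v1)" "v2 \<in> ?D" "u2 = u (abscissa v2)"
    by blast
  have bnd: "u2 \<le> u (abscissa v) \<and> u (abscissa v) \<le> u1" if "v \<in> ?D" for v
    unfolding u1_def u2_def using fin that by auto
  define x1 x2 where "x1 = abscissa v1" and "x2 = abscissa v2"
  have Fx: "\<bar>?F x1\<bar> \<le> \<epsilon>" "\<bar>?F x2\<bar> \<le> \<epsilon>" using F_D v12 by (auto simp: x1_def x2_def)
  have u12: "u1 = u x1" "u2 = u x2" "0 \<le> u2" "u2 \<le> u1"
    using v12 bnd[OF v12(1)] by (auto simp: x1_def x2_def side_def u_def)
  \<comment> \<open>Chosen so that \<open>2 * \<epsilon> * \<kappa>\<close> is 1/(8Q):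
    \<open>F\<close> may fall by this amount below \<open>- \<epsilon>\<close> and still be in the
    strip.\<close>
  define \<kappa> where "\<kappa> = 1 / (32 * of_int j * d)"
  have \<kappa>: "0 < \<kappa>" using j d by (simp add: \<kappa>_def)
  have \<kappa>\<epsilon>: "\<epsilon> * (1 + 2 * \<kappa>) \<le> 1 / (4 * Q)"
  proof -
    have "\<epsilon> * (1 + 2 * \<kappa>) = (2 * (of_int j * d) + 1 / 8) / Q"
      using j d Q by (simp add: \<epsilon>_def \<kappa>_def field_simps)
    also have "\<dots> \<le> (1 / 4) / Q" using j Q by (intro divide_right_mono) auto
    finally show ?thesis by simp
  qed
  define R where "R = u1 - u2"
  have R: "0 \<le> R" using u12 by (simp add: R_def)
  \<comment> \<open>The tangent at \<open>x2\<close> is below \<open>F\<close> at \<open>x1\<close>,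
    so its outward slope \<open>D\<close> satisfies \<open>D * R \<le> 2 * \<epsilon>\<close>.
    Followed inwards for a distance \<open>\<kappa> * R\<close> it falls by at most
    \<open>2 * \<epsilon> * \<kappa>\<close>, and \<open>F\<close> stays above it.\<close>
  have inner: "- 1 / (4 * Q) \<le> ?F z" if z: "u2 - \<kappa> * R \<le> u z" "u z \<le> u2" for z
  proof (cases "R = 0")
    case True
    then have "u z = u x2" using z u12 by simp
    then have "z = x2" using s by (auto simp: u_def)
    then show ?thesis using Fx e by simp
  next
    case False
    then have R: "0 < R" using R by simp
    define D where "D = s * (of_int j * (g x2 - g ?z))"
    define t where "t = u2 - u z"
    have t: "0 \<le> t" "t \<le> \<kappa> * R" using z by (auto simp: t_def)
    have xs: "x1 - x2 = s * R" "z - x2 = - (s * t)"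
      using s u12(1,2) by (auto simp: u_def R_def t_def)
    have q: "0 \<le> of_int j * l / 2 * (w - x2)\<^sup>2" for w using j lL by simp
    have "?F x2 + of_int j * (g x2 - g ?z) * (x1 - x2) \<le> ?F x1"
      using F_lower[OF j(2), of k n x2 x1] q[of x1] by linarith
    then have "?F x2 + D * R \<le> ?F x1" by (simp add: xs D_def mult_ac)
    then have DR: "D * R \<le> 2 * \<epsilon>" using Fx by linarith
    have "?F x2 + of_int j * (g x2 - g ?z) * (z - x2) \<le> ?F z"
      using F_lower[OF j(2), of k n x2 z] q[of z] by linarith
    then have Fz: "?F x2 - D * t \<le> ?F z" by (simp add: xs D_def mult_ac)
    have "D * t \<le> 2 * \<epsilon> * \<kappa>"
    proof (cases "D \<le> 0")
      case True
      then have "D * t \<le> 0" using t by (simp add: mult_nonpos_nonneg)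
      then show ?thesis using e \<kappa> by (smt (verit) mult_nonneg_nonneg)
    next
      case False
      then have "D * t \<le> D * (\<kappa> * R)" using t by (intro mult_left_mono) auto
      also have "\<dots> = (D * R) * \<kappa>" by simp
      also have "\<dots> \<le> 2 * \<epsilon> * \<kappa>" using DR \<kappa> by (intro mult_right_mono) auto
      finally show ?thesis .
    qed
    then have "- (\<epsilon> * (1 + 2 * \<kappa>)) \<le> ?F z" using Fz Fx by (simp add: algebra_simps)
    then show ?thesis using \<kappa>\<epsilon> by simp
  qed
  \<comment> \<open>The extension stops short of the minimum point, where \<open>F\<close> is below
    the strip.\<close>
  have pos: "\<kappa> * R < u2"
  proof (rule ccontr)
    assume "\<not> \<kappa> * R < u2"
    then have "- 1 / (4 * Q) \<le> ?F ?z" using u12 by (intro inner) (auto simp: u_def)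
    then show False using m by simp
  qed
  have strip: "\<bar>?F z\<bar> \<le> 1 / (4 * Q)" if z: "u2 - \<kappa> * R \<le> u z" "u z \<le> u1" for z
  proof -
    have "?F z \<le> ?F x1"
      using s z pos u12 by (intro F_one_side_le[OF j(2)]) (auto simp: u_def)
    moreover have "- 1 / (4 * Q) \<le> ?F z"
    proof (cases "u z \<le> u2")
      case False
      then have "?F x2 \<le> ?F z"
        using s z u12 by (intro F_one_side_le[OF j(2)]) (auto simp: u_def)
      then show ?thesis using Fx e by simp
    qed (use inner z in auto)
    ultimately show ?thesis using Fx e by (simp add: abs_le_iff)
  qed
  \<comment> \<open>A one-sided piece of the strip has length at most \<open>1 / sqrt l\<close>,
    which keeps the intervals of all planes in one bounded window.\<close>
  have range: "\<bar>z - x1\<bar> \<le> 1 / sqrt l" if z: "u2 - \<kappa> * R \<le> u z" "u z \<le> u1" for z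
  proof -
    have "of_int j * l * (z - x1)\<^sup>2 \<le> 4 * (1 / (4 * Q))"
      using strip[OF z] strip[of x1] z pos u12 R \<kappa>
      by (intro side_width[OF j(2) s, of _ k n]) (auto simp: u_def)
    also have "\<dots> \<le> 1" using Q by simp
    also have "1 \<le> real_of_int j" using j by simp
    finally have "l * (z - x1)\<^sup>2 \<le> 1" using j by (simp add: mult.assoc)
    then have "(z - x1)\<^sup>2 \<le> 1 / l" using lL by (simp add: field_simps)
    then show ?thesis by (metis real_sqrt_abs real_sqrt_divide real_sqrt_le_iff real_sqrt_one)
  qed
  have x1: "A \<le> x1" "x1 \<le> B"
    using abscissa_range[of v1] subsetD[OF side_subset(1) v12(1)] by (auto simp: x1_def)
  have "real (card ?D) \<le> 1 + Q\<^sup>2 * R / of_int j"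
  proof (rule plane_card_le)
    show "?D \<subseteq> P" "inj_on abscissa ?D" by (fact side_subset)+
    fix v w assume "v \<in> ?D" "w \<in> ?D"
    then have "\<bar>u (abscissa v) - u (abscissa w)\<bar> \<le> R"
      using bnd[of v] bnd[of w] by (auto simp: R_def)
    then show "\<bar>abscissa v - abscissa w\<bar> \<le> R" using s by (auto simp: u_def)
  qed (use j R in \<open>auto simp: side_def\<close>)
  \<comment> \<open>The \<open>j\<close> of the spacing cancels against the one in
    \<open>\<kappa>\<close>: the count is controlled by the length of the strip with a factor
    independent of the plane.\<close>
  also have "Q\<^sup>2 * R / of_int j = 32 * (d * Q\<^sup>2) * (\<kappa> * R)"
    using j d by (simp add: \<kappa>_def field_simps)
  also have "\<dots> \<le> 32 * (d * Q\<^sup>2) * ((1 + \<kappa>) * R)"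
    using d R by (intro mult_left_mono mult_right_mono) auto
  finally have crd: "real (card ?D) \<le> 1 + 32 * (d * Q\<^sup>2) * ((1 + \<kappa>) * R)" by simp
  define \<alpha> \<beta> where "\<alpha> = (if s = 1 then ?z + u2 - \<kappa> * R else ?z - u1)"
    and "\<beta> = (if s = 1 then ?z + u1 else ?z - u2 + \<kappa> * R)"
  have T: "\<alpha> \<le> z \<and> z \<le> \<beta> \<longleftrightarrow> u2 - \<kappa> * R \<le> u z \<and> u z \<le> u1" for z
    using s by (auto simp: \<alpha>_def \<beta>_def u_def)
  have len: "\<beta> - \<alpha> = (1 + \<kappa>) * R"
    by (simp add: \<alpha>_def \<beta>_def R_def algebra_simps)
  have "0 \<le> (1 + \<kappa>) * R" using \<kappa> R by simp
  then have ab: "\<alpha> \<le> \<beta>" using len by linarith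
  have "\<bar>\<alpha> - x1\<bar> \<le> 1 / sqrt l" "\<bar>\<beta> - x1\<bar> \<le> 1 / sqrt l"
    using range[of \<alpha>] range[of \<beta>] T[of \<alpha>] T[of \<beta>] ab by auto
  then have "A - 1 / sqrt l \<le> \<alpha>" "\<beta> \<le> B + 1 / sqrt l" using x1 by linarith+
  moreover have "\<alpha> \<le> abscissa v \<and> abscissa v \<le> \<beta>" if "v \<in> ?D" for v
    unfolding T using bnd[OF that] \<kappa> R by (smt (verit) mult_nonneg_nonneg)
  ultimately show ?thesis using that ab crd strip T len by metis
qed

end

section \<open>Covering by planes\<close>

context separated_points
begin

definition cell :: "int \<times> int \<times> int \<Rightarrow> int"
  where "cell v = \<lfloor>abscissa v / \<rho>\<rfloor>"

lemma same_cell_near: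
  assumes "cell v = cell w"
  shows "\<bar>abscissa v - abscissa w\<bar> \<le> \<rho>"
proof -
  have "\<bar>abscissa v / \<rho> - abscissa w / \<rho>\<bar> \<le> 1"
    using assms unfolding cell_def by linarith
  then have "\<bar>abscissa v - abscissa w\<bar> / \<rho> \<le> 1"
    using \<rho>(1) by (simp add: diff_divide_distrib[symmetric])
  then show ?thesis using \<rho>(1) by (simp add: pos_divide_le_eq)
qed

lemma card_cells: "real (card (cell ` S)) \<le> (16 * (1 + L) * (B - A) + 2) * H"
proof -
  let ?I = "{k::int. A / \<rho> - 1 \<le> of_int k \<and> of_int k \<le> B / \<rho>}"
  have AB': "A / \<rho> \<le> B / \<rho>" using AB \<rho>(1) by (simp add: divide_right_mono)
  have "cell ` S \<subseteq> ?I"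
  proof (intro image_subsetI)
    fix v assume "v \<in> S"
    then have "A \<le> abscissa v \<and> abscissa v \<le> B" using S abscissa_range[of v] by auto
    then have "A / \<rho> \<le> abscissa v / \<rho>" "abscissa v / \<rho> \<le> B / \<rho>"
      using \<rho>(1) by (auto intro: divide_right_mono)
    then show "cell v \<in> ?I" unfolding cell_def by simp linarith
  qed
  then have "card (cell ` S) \<le> card ?I"
    using AB' by (intro card_mono card_int_interval_le) auto
  also have "real (card ?I) \<le> (B - A) / \<rho> + 2"
    using card_int_interval_le(2)[of "A / \<rho> - 1" "B / \<rho>"] AB' by (simp add: diff_divide_distrib)
  also have "(B - A) / \<rho> = 16 * (1 + L) * (B - A) * H"
    using lL by (simp add: \<rho>_def c0_def)
  also have "16 * (1 + L) * (B - A) * H + 2 \<le> (16 * (1 + L) * (B - A) + 2) * H"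
    using H by (simp add: algebra_simps)
  finally show ?thesis by simp
qed

text \<open>\<open>coplanar\<close> puts the whole cell on the plane through two of its points. The
  first entry of the normal is at most Q^2 \<open>\<rho>\<close>, which the choice of
  \<open>\<rho>\<close> makes admissible.\<close>

lemma cell_plane:
  assumes vw: "v \<in> S" "w \<in> S" "v \<noteq> w" "cell v = cell w"
  shows "\<exists>c. admissible c \<and> (\<forall>u\<in>S. cell u = cell v \<longrightarrow> on_plane c u)"
proof -
  obtain q a p q' a' p' where v: "v = (q, a, p)" and w: "w = (q', a', p')" by (cases v, cases w)
  have in_P: "(q, a, p) \<in> P" "(q', a', p') \<in> P" using vw S v w by auto
  note D = P_D(1,3)[OF in_P(1)] P_D(1,3)[OF in_P(2)]
  have "abscissa v \<noteq> abscissa w" using vw inj by (auto simp: inj_on_def)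
  then have "q * a' \<noteq> q' * a" using abscissa_eq_iff[OF in_P] v w by simp
  then obtain j k n where c: "primitive (j, k, n)" "1 \<le> j" "j \<le> \<bar>q * a' - q' * a\<bar>"
    and pl: "\<And>u. det3 u (q, a, p) (q', a', p') = 0 \<Longrightarrow> on_plane (j, k, n) u"
    by (rule plane_through[where p = p and p' = p']) (rule that)
  have "of_int j \<le> \<bar>of_int q * of_int a' - of_int q' * of_int a :: real\<bar>"
    using c(3) by (metis of_int_abs of_int_diff of_int_le_iff of_int_mult)
  also have "of_int q * of_int a' - of_int q' * of_int a =
    of_int q * of_int q' * (abscissa w - abscissa v)"
    using D by (simp add: v w abscissa_def right_diff_distrib)
  also have "\<bar>\<dots>\<bar> \<le> Q * Q * \<rho>"
    unfolding abs_mult using D same_cell_near[OF vw(4)[symmetric]] Q by (intro mult_mono) auto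
  finally have j: "of_int j \<le> Q * Q * \<rho>" .
  have "of_int j * d \<le> Q * Q * \<rho> * d" using j d by (intro mult_right_mono) auto
  then have "of_int j * d \<le> 1 / 16"
    using \<rho>(3) c0 by (simp add: power2_eq_square mult_ac)
  moreover have "Q * (Q * \<rho>) \<le> Q * c0" using \<rho>(2) Q by (intro mult_left_mono) auto
  moreover have "Q * c0 \<le> Q * (1 / 16)" using c0 Q by (intro mult_left_mono) auto
  ultimately have "admissible (j, k, n)" using c j by (simp add: admissible_def)
  moreover have "on_plane (j, k, n) u" if "u \<in> S" "cell u = cell v" for u
  proof -
    have "det3 u v w = 0"
      using that vw S same_cell_near[of v u] same_cell_near[of w u] by (intro coplanar) auto
    then show ?thesis using pl v w by blast
  qed
  ultimately show ?thesis by blast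
qed

text \<open>A cell with one point is charged to the number of cells; every other cell picks one
  plane that contains all its points.\<close>

lemma plane_cover:
  obtains \<C> where "finite \<C>" "card \<C> \<le> card (cell ` S)"
    "\<And>c. c \<in> \<C> \<Longrightarrow> admissible c" "\<And>c. c \<in> \<C> \<Longrightarrow> \<exists>v\<in>S. on_plane c v"
    "card S \<le> card (cell ` S) + (\<Sum>c\<in>\<C>. card {v \<in> S. on_plane c v})"
proof -
  define fib where "fib i = {v \<in> S. cell v = i}" for i
  define bad where "bad = {i \<in> cell ` S. 2 \<le> card (fib i)}"
  have finK: "finite (cell ` S)" and finb: "finite bad" using finite_S by (auto simp: bad_def)
  have "\<exists>c. admissible c \<and> (\<forall>u\<in>fib i. on_plane c u)" if "i \<in> bad" for i
  proof -
    have "2 \<le> card (fib i)" using that by (simp add: bad_def)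
    then obtain v w where "v \<in> fib i" "w \<in> fib i" "v \<noteq> w"
      by (meson card_2_iff' ex_card subset_iff)
    then show ?thesis using cell_plane[of v w] by (auto simp: fib_def)
  qed
  then obtain pl where pl: "\<And>i. i \<in> bad \<Longrightarrow> admissible (pl i) \<and> (\<forall>u\<in>fib i. on_plane (pl i) u)"
    by metis
  let ?C = "pl ` bad"
  have "card ?C \<le> card bad" using finb by (rule card_image_le)
  also have "\<dots> \<le> card (cell ` S)" using finK by (intro card_mono) (auto simp: bad_def)
  finally have "card ?C \<le> card (cell ` S)" .
  moreover have "\<exists>v\<in>S. on_plane c v" if c: "c \<in> ?C" for c
  proof -
    obtain i where i: "i \<in> bad" "c = pl i" using c by blast
    then obtain v where "v \<in> fib i" by (auto simp: bad_def fib_def)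
    then have "v \<in> S" by (simp add: fib_def)
    then show ?thesis using pl[OF i(1)] i(2) \<open>v \<in> fib i\<close> by blast
  qed
  moreover have "card S \<le> card (cell ` S) + (\<Sum>c\<in>?C. card {v \<in> S. on_plane c v})"
  proof -
    let ?G = "\<Union>i\<in>cell ` S - bad. fib i" and ?B = "\<Union>c\<in>?C. {v \<in> S. on_plane c v}"
    have "S \<subseteq> ?G \<union> ?B"
    proof
      fix v assume v: "v \<in> S"
      show "v \<in> ?G \<union> ?B"
      proof (cases "cell v \<in> bad")
        case True
        have "v \<in> fib (cell v)" using v by (simp add: fib_def)
        then show ?thesis using pl[OF True] v True by blast
      qed (use v in \<open>auto simp: fib_def\<close>)
    qed
    moreover have "finite ?G" "finite ?B" using finite_S finb by (auto simp: fib_def)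
    ultimately have "card S \<le> card ?G + card ?B"
      by (meson card_Un_le card_mono finite_UnI order_trans)
    moreover have "card ?G \<le> (\<Sum>i\<in>cell ` S - bad. card (fib i))"
      using finK by (intro card_UN_le) auto
    moreover have "(\<Sum>i\<in>cell ` S - bad. card (fib i)) \<le> (\<Sum>i\<in>cell ` S - bad. 1)"
      by (intro sum_mono) (auto simp: bad_def)
    moreover have "(\<Sum>i\<in>cell ` S - bad. 1) \<le> card (cell ` S)"
      using finK by (simp add: card_mono)
    moreover have "card ?B \<le> (\<Sum>c\<in>?C. card {v \<in> S. on_plane c v})"
      using finb by (intro card_UN_le) auto
    ultimately show ?thesis by linarith
  qed
  ultimately show ?thesis using that[of ?C] finb pl by blast
qed

lemma same_plane:
  assumes "admissible c" "admissible c'" "v \<in> S" "w \<in> S" "v \<noteq> w"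
    and "on_plane c v" "on_plane c w" "on_plane c' v" "on_plane c' w"
  shows "c = c'"
proof -
  obtain q a p q' a' p' where v: "v = (q, a, p)" and w: "w = (q', a', p')" by (cases v, cases w)
  obtain j k n j' k' n' where c: "c = (j, k, n)" "c' = (j', k', n')" by (cases c, cases c')
  have in_P: "(q, a, p) \<in> P" "(q', a', p') \<in> P" using assms S v w by auto
  have "abscissa v \<noteq> abscissa w" using assms inj by (auto simp: inj_on_def)
  then have "q * a' \<noteq> q' * a" using abscissa_eq_iff[OF in_P] v w by simp
  then show ?thesis
    using plane_unique[of q a' q' a j k n j' k' n' p p'] assms
      admissible_D[of j k n] admissible_D[of j' k' n'] by (auto simp: v w c)
qed

text \<open>Sides of at most three points are absorbed by the number of planes. The strips of the
  others overlap at most twice in a window of length B - A + 2/sqrt l, which bounds the sum of their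
  lengths and, by \<open>transversal_side\<close>, their points.\<close>

lemma card_transversal:
  assumes fin: "finite \<C>" and adm: "\<And>c. c \<in> \<C> \<Longrightarrow> admissible c"
    and m: "\<And>c. c \<in> \<C> \<Longrightarrow> F c (\<zeta> c) < - 1 / (4 * Q)" and s: "s = 1 \<or> s = -1"
  shows "real (\<Sum>c\<in>\<C>. card (side s c)) \<le>
    4 * real (card \<C>) + 64 * (B - A + 2 / sqrt l) * (d * Q\<^sup>2)"
proof -
  \<comment> \<open>Four points suffice: however \<open>x\<close> cuts such a side, one part keeps
    at least two.\<close>
  define \<D> where "\<D> = {c \<in> \<C>. 4 \<le> card (side s c)}"
  have finD: "finite \<D>" using fin by (simp add: \<D>_def)
  have "\<exists>\<alpha> \<beta>. A - 1 / sqrt l \<le> \<alpha> \<and> \<alpha> \<le> \<beta> \<and> \<beta> \<le> B + 1 / sqrt l \<and>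
    real (card (side s c)) \<le> 1 + 32 * (d * Q\<^sup>2) * (\<beta> - \<alpha>) \<and>
    (\<forall>x. \<alpha> \<le> x \<and> x \<le> \<beta> \<longrightarrow> \<bar>F c x\<bar> \<le> 1 / (4 * Q)) \<and>
    (\<forall>v\<in>side s c. \<alpha> \<le> abscissa v \<and> abscissa v \<le> \<beta>)" if c: "c \<in> \<D>" for c
  proof -
    obtain j k n where jkn: "c = (j, k, n)" by (cases c)
    have "side s c \<noteq> {}" using c by (auto simp: \<D>_def)
    moreover have "admissible c" "F c (\<zeta> c) < - 1 / (4 * Q)" using adm m c by (auto simp: \<D>_def)
    ultimately show ?thesis unfolding jkn using transversal_side[OF _ s, of j k n] by metis
  qed
  then obtain \<alpha> \<beta> where ab: "\<And>c. c \<in> \<D> \<Longrightarrow> A - 1 / sqrt l \<le> \<alpha> c \<and> \<alpha> c \<le> \<beta> c \<and> \<beta> c \<le> B + 1 / sqrt l"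
    and crd: "\<And>c. c \<in> \<D> \<Longrightarrow> real (card (side s c)) \<le> 1 + 32 * (d * Q\<^sup>2) * (\<beta> c - \<alpha> c)"
    and strip: "\<And>c x. c \<in> \<D> \<Longrightarrow> \<alpha> c \<le> x \<Longrightarrow> x \<le> \<beta> c \<Longrightarrow> \<bar>F c x\<bar> \<le> 1 / (4 * Q)"
    and side: "\<And>c v. c \<in> \<D> \<Longrightarrow> v \<in> side s c \<Longrightarrow> \<alpha> c \<le> abscissa v \<and> abscissa v \<le> \<beta> c"
    by metis
  \<comment> \<open>\<open>F\<close> is small over the whole interval, so a point of
    \<open>S\<close> over it that came from another plane lies on this plane as well.\<close>
  have pl: "on_plane c v" if "c \<in> \<D>" "v \<in> S" "\<alpha> c \<le> abscissa v" "abscissa v \<le> \<beta> c" for c v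
  proof -
    obtain j k n where jkn: "c = (j, k, n)" by (cases c)
    have "admissible c" using that adm by (simp add: \<D>_def)
    moreover have "v \<in> P" using that S by blast
    ultimately show ?thesis
      using strip[OF that(1,3,4)] unfolding jkn by (rule on_plane_if_F_small)
  qed
  have uniq: "c = c'" if c: "c \<in> \<D>" "c' \<in> \<D>" and T: "T \<subseteq> S" "2 \<le> card T"
    and sub: "\<And>v. v \<in> T \<Longrightarrow> \<alpha> c \<le> abscissa v \<and> abscissa v \<le> \<beta> c \<and>
      \<alpha> c' \<le> abscissa v \<and> abscissa v \<le> \<beta> c'" for c c' T
  proof -
    obtain v w where "v \<in> T" "w \<in> T" "v \<noteq> w"
      using T(2) by (meson card_2_iff' ex_card subset_iff)
    moreover from this have "v \<in> S" "w \<in> S" using T by auto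
    moreover have "admissible c" "admissible c'" using c adm by (auto simp: \<D>_def)
    ultimately show ?thesis
      using sub[of v] sub[of w] c by (intro same_plane[of c c' v w] pl) simp_all
  qed
  text \<open>Two strips that cover \<open>x\<close> and both contain two points to the left of \<open>x\<close> share two
    points, so they belong to the same plane; likewise on the right.\<close>
  have mult: "card {c \<in> \<D>. \<alpha> c \<le> x \<and> x \<le> \<beta> c} \<le> 2" for x
  proof -
    define lft where "lft c = {v \<in> S. \<alpha> c \<le> abscissa v \<and> abscissa v \<le> x}" for c
    define rgt where "rgt c = {v \<in> S. x \<le> abscissa v \<and> abscissa v \<le> \<beta> c}" for c
    let ?X = "{c \<in> \<D>. \<alpha> c \<le> x \<and> x \<le> \<beta> c}"
    let ?L = "{c \<in> ?X. 2 \<le> card (lft c)}" and ?R = "{c \<in> ?X. 2 \<le> card (rgt c)}"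
    have "?X \<subseteq> ?L \<union> ?R"
    proof
      fix c assume c: "c \<in> ?X"
      have "side s c \<subseteq> lft c \<union> rgt c"
      proof
        fix v assume v: "v \<in> side s c"
        then have "\<alpha> c \<le> abscissa v \<and> abscissa v \<le> \<beta> c" using side c by blast
        moreover have "v \<in> S" using v by (simp add: side_def)
        ultimately show "v \<in> lft c \<union> rgt c" by (simp add: lft_def rgt_def) linarith
      qed
      moreover have "finite (lft c)" "finite (rgt c)" using finite_S by (auto simp: lft_def rgt_def)
      ultimately have "card (side s c) \<le> card (lft c) + card (rgt c)"
        by (meson card_Un_le card_mono finite_UnI order_trans)
      then show "c \<in> ?L \<union> ?R" using c by (auto simp: \<D>_def)
    qed
    moreover have "card ?L \<le> Suc 0"
    proof (subst card_le_Suc0_iff_eq)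
      show "\<forall>c\<in>?L. \<forall>c'\<in>?L. c = c'"
      proof (intro ballI)
        fix c c' assume c: "c \<in> ?L" "c' \<in> ?L"
        show "c = c'"
        \<comment> \<open>The left points of the strip that begins later lie in both strips.\<close>
        proof (cases "\<alpha> c \<le> \<alpha> c'")
          case True
          show ?thesis by (rule uniq[of c c' "lft c'"]) (use c True in \<open>auto simp: lft_def\<close>)
        next
          case False
          show ?thesis by (rule uniq[of c c' "lft c"]) (use c False in \<open>auto simp: lft_def\<close>)
        qed
      qed
    qed (use finD in auto)
    moreover have "card ?R \<le> Suc 0"
    proof (subst card_le_Suc0_iff_eq)
      show "\<forall>c\<in>?R. \<forall>c'\<in>?R. c = c'"
      proof (intro ballI)
        fix c c' assume c: "c \<in> ?R" "c' \<in> ?R"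
        show "c = c'"
        proof (cases "\<beta> c \<le> \<beta> c'")
          case True
          show ?thesis by (rule uniq[of c c' "rgt c"]) (use c True in \<open>auto simp: rgt_def\<close>)
        next
          case False
          show ?thesis by (rule uniq[of c c' "rgt c'"]) (use c False in \<open>auto simp: rgt_def\<close>)
        qed
      qed
    qed (use finD in auto)
    moreover have "card ?X \<le> card (?L \<union> ?R)"
      using \<open>?X \<subseteq> ?L \<union> ?R\<close> finD by (intro card_mono) auto
    ultimately show ?thesis using card_Un_le[of ?L ?R] by linarith
  qed
  have "0 < sqrt l" using lL by simp
  then have len: "(\<Sum>c\<in>\<D>. \<beta> c - \<alpha> c) \<le> real 2 * ((B + 1 / sqrt l) - (A - 1 / sqrt l))"
    using finD AB ab mult by (intro sum_lengths_le) (auto intro: order_trans)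
  have "real (\<Sum>c\<in>\<D>. card (side s c)) \<le> (\<Sum>c\<in>\<D>. 1 + 32 * (d * Q\<^sup>2) * (\<beta> c - \<alpha> c))"
    unfolding of_nat_sum by (intro sum_mono crd)
  also have "\<dots> = real (card \<D>) + 32 * (d * Q\<^sup>2) * (\<Sum>c\<in>\<D>. \<beta> c - \<alpha> c)"
    by (simp only: sum.distrib sum_distrib_left) simp
  also have "\<dots> \<le> real (card \<D>) + 32 * (d * Q\<^sup>2) * (real 2 * ((B + 1 / sqrt l) - (A - 1 / sqrt l)))"
    using len d by (intro add_left_mono mult_left_mono) auto
  finally have 1: "real (\<Sum>c\<in>\<D>. card (side s c)) \<le>
    real (card \<D>) + 64 * (B - A + 2 / sqrt l) * (d * Q\<^sup>2)" by (simp add: algebra_simps)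
  have "(\<Sum>c\<in>\<C> - \<D>. card (side s c)) \<le> (\<Sum>c\<in>\<C> - \<D>. 3)"
    by (intro sum_mono) (auto simp: \<D>_def)
  also have "\<dots> = 3 * card (\<C> - \<D>)" by simp
  also have "\<dots> \<le> 3 * card \<C>" using fin by (simp add: card_mono)
  finally have 2: "(\<Sum>c\<in>\<C> - \<D>. card (side s c)) \<le> 3 * card \<C>" .
  have "card \<D> \<le> card \<C>" using fin by (simp add: card_mono \<D>_def)
  moreover have "(\<Sum>c\<in>\<C>. card (side s c)) =
    (\<Sum>c\<in>\<C> - \<D>. card (side s c)) + (\<Sum>c\<in>\<D>. card (side s c))"
    using fin by (intro sum.subset_diff) (auto simp: \<D>_def)
  ultimately show ?thesis using 1 2 by linarith
qed

end

text \<open>The normal \<open>(j, k, n)\<close> of a plane is at the same time a triple for the dual curve, because the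
  minimum of \<open>F\<close> is \<open>n - j f\<^sup>*(k/j)\<close> with \<open>f\<^sup>*\<close> the Legendre transform.\<close>

definition dual_planes :: "(real \<Rightarrow> real) \<Rightarrow> (real \<Rightarrow> real) \<Rightarrow> real \<Rightarrow> real \<Rightarrow> real \<Rightarrow> real \<Rightarrow> real \<Rightarrow> (int \<times> int \<times> int) set"
  where "dual_planes f g l A B Q d = {(j, k, n). 1 \<le> j \<and> of_int j * d \<le> 1 / 16 \<and> of_int j \<le> Q / 16 \<and>
    (\<forall>D. D / 2 < of_int j \<longrightarrow> of_int j \<le> D \<longrightarrow>
      (j, k, n) \<in> prim_triples (legendre f g) (g (A - 1 / sqrt l)) (g (B + 1 / sqrt l)) D (1 / (4 * Q)))}"

text \<open>The summands pay, in order, for cells and planes, with 11 = 1 + 2 + 8 for one-point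
  cells, tangent planes and transversal planes; for the lengths of strips; for repeated abscissae;
  and for the widths of tangent sides.\<close>

definition main_const :: "real \<Rightarrow> real \<Rightarrow> real \<Rightarrow> real \<Rightarrow> real"
  where "main_const l L A B =
    11 * (16 * (1 + L) * (B - A) + 2) + 128 * (B - A + 2 / sqrt l) + 4 * (B - A + 1) + 2 * sqrt (8 / l)"

section \<open>Tangent planes and the main inequality\<close>

context separated_points
begin

text \<open>The minimum of \<open>F\<close> is at least -1/(4Q) by hypothesis and at most the value
  at \<open>v\<close>; up to sign it is the error of the dual triple. Quadratic growth keeps the
  minimum point within \<open>1 / sqrt l\<close> of the abscissa of \<open>v\<close>, whence the
  widened interval in \<open>dual_planes\<close>.\<close>

lemma tangent_dual:
  assumes adm: "admissible c" and v: "v \<in> S" "on_plane c v"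
    and m: "\<not> F c (\<zeta> c) < - 1 / (4 * Q)"
  shows "c \<in> dual_planes f g l A B Q d"
proof -
  obtain j k n where c: "c = (j, k, n)" by (cases c)
  note j = admissible_D[OF adm[unfolded c]]
  define z x where "z = \<zeta> (j, k, n)" and "x = abscissa v"
  have vP: "v \<in> P" using v S by auto
  have z: "of_int j * g z = of_int k" using \<zeta>_slope[OF j(2)] by (simp add: z_def)
  have m: "- 1 / (4 * Q) \<le> F c z" using m by (simp add: c z_def)
  have "2 * of_int j * d / Q \<le> (1 / 4) / Q" using j(3) Q by (intro divide_right_mono) auto
  then have Fx: "F c x \<le> 1 / (4 * Q)"
    using F_at_point[OF vP v(2)[unfolded c] j(2)] by (simp add: x_def c)
  have q: "F c z + of_int j * l / 2 * (x - z)\<^sup>2 \<le> F c x"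
    using F_lower[OF j(2), of k n z x] by (simp add: c z_def)
  moreover have "0 \<le> of_int j * l / 2 * (x - z)\<^sup>2" using j lL by simp
  ultimately have Fz: "\<bar>F c z\<bar> \<le> 1 / (4 * Q)" using m Fx by (simp add: abs_le_iff)
  have "of_int j * l / 2 * (x - z)\<^sup>2 \<le> 2 * (1 / (4 * Q))" using q m Fx by simp
  also have "\<dots> \<le> 1 / 2" using Q by simp
  finally have "of_int j * (l * (x - z)\<^sup>2) \<le> 1" by simp
  moreover have "1 * (l * (x - z)\<^sup>2) \<le> of_int j * (l * (x - z)\<^sup>2)"
    using j lL by (intro mult_right_mono) auto
  ultimately have "l * (x - z)\<^sup>2 \<le> 1" by linarith
  then have "(x - z)\<^sup>2 \<le> 1 / l" using lL by (simp add: field_simps)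
  then have "\<bar>x - z\<bar> \<le> 1 / sqrt l"
    by (metis real_sqrt_abs real_sqrt_divide real_sqrt_le_iff real_sqrt_one)
  then have "A - 1 / sqrt l \<le> z" "z \<le> B + 1 / sqrt l"
    using abscissa_range[OF vP] by (auto simp: x_def)
  then have g: "g (A - 1 / sqrt l) \<le> g z" "g z \<le> g (B + 1 / sqrt l)"
    by (auto intro: pinched_slope_mono[OF pinched])
  have g': "g (A - 1 / sqrt l) * of_int j \<le> of_int k" "of_int k \<le> g (B + 1 / sqrt l) * of_int j"
    unfolding z[symmetric] using mult_right_mono[OF g(1), of "of_int j"]
      mult_right_mono[OF g(2), of "of_int j"] j by (auto simp: mult.commute)
  have "of_int j * legendre f g (of_int k / of_int j) = of_int k * z - of_int j * f z"
    using j unfolding legendre_def z_def \<zeta>_def by (simp add: right_diff_distrib)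
  then have "of_int j * legendre f g (of_int k / of_int j) - of_int n = - F c z"
    by (simp add: c F_def)
  then have "\<bar>of_int j * legendre f g (of_int k / of_int j) - of_int n\<bar> \<le> 1 / (4 * Q)"
    using Fz by simp
  then show ?thesis using j g'
    by (auto simp: c dual_planes_def prim_triples_def near_triples_def)
qed

lemma main_inequality_separated:
  obtains \<T> where "finite \<T>" "\<T> \<subseteq> dual_planes f g l A B Q d"
    "real (card \<T>) \<le> (16 * (1 + L) * (B - A) + 2) * H"
    "real (card S) \<le> (11 * (16 * (1 + L) * (B - A) + 2) + 128 * (B - A + 2 / sqrt l)) * H +
       2 * sqrt (8 / l) * (Q\<^sup>2 * sqrt (d / Q) * (\<Sum>c\<in>\<T>. 1 / of_int (fst c)))"
proof -
  obtain \<C> where C: "finite \<C>" "card \<C> \<le> card (cell ` S)" "\<And>c. c \<in> \<C> \<Longrightarrow> admissible c"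
    "\<And>c. c \<in> \<C> \<Longrightarrow> \<exists>v\<in>S. on_plane c v"
    "card S \<le> card (cell ` S) + (\<Sum>c\<in>\<C>. card {v \<in> S. on_plane c v})"
    by (rule plane_cover) (rule that)
  define N where "N = (\<lambda>c. card {v \<in> S. on_plane c v})"
  \<comment> \<open>Planes for which \<open>F\<close> falls below the strip go to
    \<open>card_transversal\<close>; the rest are tangent and go to \<open>card_side_le\<close>,
    which produces the sum of 1/j.\<close>
  define \<V> where "\<V> = {c \<in> \<C>. F c (\<zeta> c) < - 1 / (4 * Q)}"
  define \<T> where "\<T> = \<C> - \<V>"
  define K where "K = 16 * (1 + L) * (B - A) + 2"
  have fin: "finite \<V>" "finite \<T>" and sub: "\<V> \<subseteq> \<C>" using C by (auto simp: \<V>_def \<T>_def)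
  have cells: "real (card (cell ` S)) \<le> K * H" using card_cells by (simp add: K_def)
  have crd: "card \<V> \<le> card (cell ` S)" "card \<T> \<le> card (cell ` S)"
    using C(1,2) card_mono[of \<C> \<V>] card_mono[of \<C> \<T>] by (auto simp: \<V>_def \<T>_def)
  have dual: "\<T> \<subseteq> dual_planes f g l A B Q d"
    using C(3,4) tangent_dual by (fastforce simp: \<T>_def \<V>_def)
  define W where "W = B - A + 2 / sqrt l"
  have W: "0 \<le> W" using AB lL by (simp add: W_def)
  have side: "real (\<Sum>c\<in>\<V>. card (side s c)) \<le> 4 * real (card \<V>) + 64 * W * (d * Q\<^sup>2)"
    if "s = 1 \<or> s = -1" for s
    unfolding W_def using C fin that by (intro card_transversal) (auto simp: \<V>_def)
  have "(\<Sum>c\<in>\<V>. N c) \<le> (\<Sum>c\<in>\<V>. card (side 1 c) + card (side (-1) c))"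
    unfolding N_def by (intro sum_mono card_on_plane)
  then have "real (\<Sum>c\<in>\<V>. N c) \<le> real (\<Sum>c\<in>\<V>. card (side 1 c)) + real (\<Sum>c\<in>\<V>. card (side (-1) c))"
    by (simp only: sum.distrib of_nat_add[symmetric] of_nat_le_iff)
  also have "\<dots> \<le> 8 * real (card \<V>) + 128 * W * (d * Q\<^sup>2)" using side[of 1] side[of "-1"] by simp
  also have "\<dots> \<le> 8 * (K * H) + 128 * W * H"
    using crd(1) cells H W by (intro add_mono mult_left_mono) auto
  finally have transversal: "real (\<Sum>c\<in>\<V>. N c) \<le> 8 * (K * H) + 128 * W * H" .
  define E where "E = Q\<^sup>2 * sqrt (8 * d / (l * Q))"
  have N: "real (N c) \<le> 2 + 2 * (E * (1 / of_int (fst c)))" if c: "c \<in> \<T>" for c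
  proof -
    obtain j k n where jkn: "c = (j, k, n)" by (cases c)
    have adm: "admissible (j, k, n)" using c C jkn by (auto simp: \<T>_def)
    show ?thesis
      using card_on_plane[of c] card_side_le[OF adm, of 1] card_side_le[OF adm, of "-1"]
      by (simp add: N_def E_def jkn)
  qed
  have "real (\<Sum>c\<in>\<T>. N c) \<le> (\<Sum>c\<in>\<T>. 2 + 2 * (E * (1 / of_int (fst c))))"
    unfolding of_nat_sum by (intro sum_mono N)
  also have "\<dots> = 2 * real (card \<T>) + 2 * E * (\<Sum>c\<in>\<T>. 1 / of_int (fst c))"
    by (simp add: sum.distrib sum_distrib_left)
  finally have tangent: "real (\<Sum>c\<in>\<T>. N c) \<le> 2 * (K * H) + 2 * E * (\<Sum>c\<in>\<T>. 1 / of_int (fst c))"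
    using crd(2) cells by simp
  have "(\<Sum>c\<in>\<C>. N c) = (\<Sum>c\<in>\<T>. N c) + (\<Sum>c\<in>\<V>. N c)"
    unfolding \<T>_def using C(1) sub by (intro sum.subset_diff) auto
  then have "real (card S) \<le> real (card (cell ` S)) + real (\<Sum>c\<in>\<T>. N c) + real (\<Sum>c\<in>\<V>. N c)"
    using C(5)[folded N_def] by (simp only: of_nat_add[symmetric] of_nat_le_iff)
  also have "\<dots> \<le> K * H + (2 * (K * H) + 2 * E * (\<Sum>c\<in>\<T>. 1 / of_int (fst c))) +
      (8 * (K * H) + 128 * W * H)"
    using cells tangent transversal by linarith
  also have "\<dots> = (11 * K + 128 * W) * H + 2 * E * (\<Sum>c\<in>\<T>. 1 / of_int (fst c))"
    by (simp add: algebra_simps)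
  also have "E = sqrt (8 / l) * (Q\<^sup>2 * sqrt (d / Q))"
    by (simp add: E_def real_sqrt_mult[symmetric])
  finally have "real (card S) \<le> (11 * K + 128 * W) * H +
      2 * sqrt (8 / l) * (Q\<^sup>2 * sqrt (d / Q) * (\<Sum>c\<in>\<T>. 1 / of_int (fst c)))"
    by (simp add: mult_ac)
  moreover have "real (card \<T>) \<le> K * H" using crd(2) cells by simp
  ultimately show ?thesis using that fin dual by (auto simp: K_def W_def)
qed

end

text \<open>The count for \<open>f\<close> is reduced to a sum of 1/j over a set of dual triples,
  into which a bound for the dual curve can be inserted.\<close>

lemma main_inequality:
  assumes "pinched f g l L" "A \<le> B" "1 \<le> Q" "0 < d"
  obtains \<T> where "finite \<T>" "\<T> \<subseteq> dual_planes f g l A B Q d"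
    "real (card \<T>) \<le> main_const l L A B * (d * Q\<^sup>2 + Q)"
    "real (card (prim_triples f A B Q d)) \<le> main_const l L A B *
      (d * Q\<^sup>2 + Q + Q\<^sup>2 * sqrt (d / Q) * (\<Sum>c\<in>\<T>. 1 / of_int (fst c)))"
proof -
  interpret near_curve f g l L A B Q d using assms by unfold_locales
  obtain S where S0: "S \<subseteq> P" "inj_on abscissa S"
    "real (card P) \<le> real (card S) + 4 * (B - A + 1) * (d * Q\<^sup>2)"
    by (rule distinct_abscissae) (rule that)
  interpret separated_points f g l L A B Q d S using S0 by unfold_locales
  obtain \<T> where T: "finite \<T>" "\<T> \<subseteq> dual_planes f g l A B Q d"
    "real (card \<T>) \<le> (16 * (1 + L) * (B - A) + 2) * H"
    "real (card S) \<le> (11 * (16 * (1 + L) * (B - A) + 2) + 128 * (B - A + 2 / sqrt l)) * H +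
       2 * sqrt (8 / l) * (Q\<^sup>2 * sqrt (d / Q) * (\<Sum>c\<in>\<T>. 1 / of_int (fst c)))"
    by (rule main_inequality_separated) (rule that)
  define K1 K2 K3 K4 where "K1 = 16 * (1 + L) * (B - A) + 2" and "K2 = 128 * (B - A + 2 / sqrt l)"
    and "K3 = 4 * (B - A + 1)" and "K4 = 2 * sqrt (8 / l)"
  have K: "0 \<le> K1" "0 \<le> K2" "0 \<le> K3" "0 \<le> K4"
    using lL AB by (auto simp: K1_def K2_def K3_def K4_def)
  have M: "main_const l L A B = 11 * K1 + K2 + K3 + K4"
    by (simp add: main_const_def K1_def K2_def K3_def K4_def)
  define G where "G = Q\<^sup>2 * sqrt (d / Q) * (\<Sum>c\<in>\<T>. 1 / of_int (fst c))"
  have "0 \<le> (\<Sum>c\<in>\<T>. 1 / real_of_int (fst c))"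
    using T(2) by (intro sum_nonneg) (auto simp: dual_planes_def)
  then have G: "0 \<le> G" using Q d by (simp add: G_def)
  have H0: "0 \<le> H" using H by simp
  have "real (card P) \<le> (11 * K1 + K2) * H + K4 * G + K3 * H"
    using S0(3) T(4) mult_left_mono[OF H(3) K(3)] by (simp add: K1_def K2_def K3_def K4_def G_def)
  also have "\<dots> = (11 * K1 + K2 + K3) * H + K4 * G" by (simp add: algebra_simps)
  also have "\<dots> \<le> main_const l L A B * H + main_const l L A B * G"
    by (intro add_mono mult_right_mono H0 G) (use K in \<open>auto simp: M\<close>)
  finally have 1: "real (card P) \<le> main_const l L A B * (d * Q\<^sup>2 + Q + G)"
    by (simp add: H_def distrib_left)
  have "K1 * H \<le> main_const l L A B * H" using K H0 unfolding M by (intro mult_right_mono) auto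
  then have 2: "real (card \<T>) \<le> main_const l L A B * (d * Q\<^sup>2 + Q)"
    using T(3) by (simp add: K1_def H_def)
  show ?thesis using that[OF T(1,2) 2] 1 by (simp add: G_def)
qed

section \<open>Iteration along the dual curve\<close>

text \<open>All pinched functions are quantified at once, so that the bound for a Legendre transform
  can be used for the function itself. The range of \<open>d\<close> covers the dual tolerance
  1/(4Q) at every size up to \<open>Q\<close>.\<close>

definition sparse_exponent :: "real \<Rightarrow> bool"
  where "sparse_exponent s \<longleftrightarrow> (\<forall>f g l L A B. pinched f g l L \<longrightarrow> A \<le> B \<longrightarrow>
    (\<exists>C\<ge>0. \<forall>Q d. 1 \<le> Q \<longrightarrow> 0 < d \<longrightarrow> d \<le> 1 / (4 * Q) \<longrightarrow>
      real (card (prim_triples f A B Q d)) \<le> C * Q powr (1 + s)))"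

text \<open>As \<open>d\<close> is at most 1/4, \<open>q\<close> and \<open>a\<close> determine
  \<open>p\<close>, and there are O(Q^2) pairs.\<close>

lemma sparse_exponent_1: "sparse_exponent 1"
  unfolding sparse_exponent_def
proof (intro allI impI exI[of _ "B - A + 1" for A B] conjI)
  fix f g :: "real \<Rightarrow> real" and l L A B :: real
  assume f: "pinched f g l L" and AB: "A \<le> B"
  show "0 \<le> B - A + 1" using AB by simp
  fix Q d :: real assume Q: "1 \<le> Q" and d: "0 < d" "d \<le> 1 / (4 * Q)"
  interpret nc: near_curve f g l L A B Q d using f AB Q d by unfold_locales
  let ?P = "prim_triples f A B Q d"
  let ?\<pi> = "\<lambda>(q::int, a::int, p::int). (q, a)"
  let ?I = "\<lambda>q::int. {a::int. A * of_int q \<le> of_int a \<and> of_int a \<le> B * of_int q}"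
  have "1 / (4 * Q) \<le> 1 / 4" using Q by simp
  then have d4: "d \<le> 1 / 4" using d by linarith
  have "inj_on ?\<pi> ?P"
  proof (rule inj_onI)
    fix v w assume v: "v \<in> ?P" and w: "w \<in> ?P" and eq: "?\<pi> v = ?\<pi> w"
    obtain q a p p' where vw: "v = (q, a, p)" "w = (q, a, p')"
      using eq by (cases v, cases w) auto
    have "\<bar>of_int q * f (of_int a / of_int q) - of_int p\<bar> \<le> d"
      "\<bar>of_int q * f (of_int a / of_int q) - of_int p'\<bar> \<le> d"
      using v w vw nc.P_D(6) by auto
    then have "\<bar>real_of_int p - of_int p'\<bar> < 1" using d4 by linarith
    then show "v = w" by (simp add: vw)
  qed
  moreover have "?\<pi> ` ?P \<subseteq> Sigma {1..\<lfloor>Q\<rfloor>} ?I"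
  proof (intro image_subsetI)
    fix v assume v: "v \<in> ?P"
    obtain q a p where vq: "v = (q, a, p)" by (cases v)
    have "0 < q" "of_int q \<le> Q" using v nc.P_D(1,3)[of q a p] vq by auto
    then have "q \<in> {1..\<lfloor>Q\<rfloor>}" by (simp add: le_floor_iff)
    moreover have "a \<in> ?I q" using v by (simp add: vq prim_triples_def near_triples_def)
    ultimately show "?\<pi> v \<in> Sigma {1..\<lfloor>Q\<rfloor>} ?I" by (simp add: vq)
  qed
  moreover have fin: "finite (?I q)" and crd: "real (card (?I q)) \<le> (B - A + 1) * Q"
    if q: "q \<in> {1..\<lfloor>Q\<rfloor>}" for q
  proof -
    have "A * of_int q \<le> B * of_int q" using AB q by (intro mult_right_mono) auto
    note I = card_int_interval_le[OF this]
    show "finite (?I q)" by (fact I(1))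
    have "real (card (?I q)) \<le> (B - A) * of_int q + 1"
      using I(2) by (simp add: left_diff_distrib)
    also have "\<dots> \<le> (B - A) * Q + Q"
      using AB q Q by (intro add_mono mult_left_mono) (auto simp: le_floor_iff)
    finally show "real (card (?I q)) \<le> (B - A + 1) * Q" by (simp add: algebra_simps)
  qed
  ultimately have "card ?P \<le> card (Sigma {1..\<lfloor>Q\<rfloor>} ?I)"
    by (intro card_inj_on_le) auto
  also have "\<dots> = (\<Sum>q\<in>{1..\<lfloor>Q\<rfloor>}. card (?I q))" using fin by (simp add: card_SigmaI)
  finally have "real (card ?P) \<le> (\<Sum>q\<in>{1..\<lfloor>Q\<rfloor>}. real (card (?I q)))"
    by (simp only: of_nat_sum[symmetric] of_nat_le_iff)
  also have "\<dots> \<le> (\<Sum>q\<in>{1..\<lfloor>Q\<rfloor>}. (B - A + 1) * Q)" by (intro sum_mono crd)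
  also have "\<dots> = of_int \<lfloor>Q\<rfloor> * ((B - A + 1) * Q)" using Q by simp
  also have "\<dots> \<le> Q * ((B - A + 1) * Q)" using AB Q by (intro mult_right_mono) auto
  also have "\<dots> = (B - A + 1) * Q powr (1 + 1)"
    using Q by (simp add: powr_add power2_eq_square)
  finally show "real (card ?P) \<le> (B - A + 1) * Q powr (1 + 1)" .
qed

text \<open>A block (D/2, D] holds at most C D^(1+s) normals, each with 1/j < 2/D, and the blocks
  add up to a geometric series of ratio 2^s.\<close>

lemma dyadic_recip_sum:
  assumes fin: "finite \<T>" and sub: "\<T> \<subseteq> dual_planes f g l A B Q d" and s: "0 < s" and C: "0 \<le> C"
    and fin': "\<And>D. 1 \<le> D \<Longrightarrow> D \<le> Q \<Longrightarrow>
      finite (prim_triples (legendre f g) (g (A - 1 / sqrt l)) (g (B + 1 / sqrt l)) D (1 / (4 * Q)))"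
    and bound: "\<And>D. 1 \<le> D \<Longrightarrow> D \<le> Q \<Longrightarrow>
      real (card (prim_triples (legendre f g) (g (A - 1 / sqrt l)) (g (B + 1 / sqrt l)) D (1 / (4 * Q))))
        \<le> C * D powr (1 + s)"
  shows "(\<Sum>c\<in>{c \<in> \<T>. fst c \<le> 2 ^ m}. 1 / real_of_int (fst c)) \<le>
    2 * C * 2 powr s / (2 powr s - 1) * (2 ^ m) powr s"
proof -
  have s1: "1 < 2 powr s" using s by simp
  \<comment> \<open>The solution of K + 2 C 2^s = K 2^s, which closes the induction.\<close>
  define K where "K = 2 * C * 2 powr s / (2 powr s - 1)"
  have j: "1 \<le> fst c \<and> of_int (fst c) \<le> Q / 16" if "c \<in> \<T>" for c
    using that sub by (auto simp: dual_planes_def)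
  have block: "(\<Sum>c\<in>{c \<in> \<T>. D / 2 < of_int (fst c) \<and> of_int (fst c) \<le> D}. 1 / real_of_int (fst c))
    \<le> 2 * C * D powr s" if D: "1 \<le> D" for D
  proof (cases "{c \<in> \<T>. D / 2 < of_int (fst c) \<and> of_int (fst c) \<le> D} = {}")
    case True
    show ?thesis unfolding True using C by simp
  next
    case False
    let ?U = "{c \<in> \<T>. D / 2 < of_int (fst c) \<and> of_int (fst c) \<le> D}"
    \<comment> \<open>A normal in the block bounds \<open>D\<close> by twice its first entry, hence
      by \<open>Q\<close>, which makes the hypotheses on \<open>D\<close> available.\<close>
    obtain c where c: "c \<in> \<T>" "D / 2 < of_int (fst c)" using False by auto
    have "1 \<le> real_of_int (fst c)" "real_of_int (fst c) \<le> Q / 16" using j[OF c(1)] by auto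
    then have DQ: "D \<le> Q" using c(2) by linarith
    have "?U \<subseteq> prim_triples (legendre f g) (g (A - 1 / sqrt l)) (g (B + 1 / sqrt l)) D (1 / (4 * Q))"
      using sub by (auto simp: dual_planes_def)
    then have "real (card ?U) \<le> C * D powr (1 + s)"
      using bound[OF D DQ] card_mono[OF fin'[OF D DQ]] by (meson of_nat_mono order_trans)
    then have "real (card ?U) * (2 / D) \<le> C * D powr (1 + s) * (2 / D)"
      using D by (intro mult_right_mono) auto
    moreover have "(\<Sum>c\<in>?U. 1 / real_of_int (fst c)) \<le> (\<Sum>c\<in>?U. 2 / D)"
      using D by (intro sum_mono) (auto simp: field_simps)
    moreover have "C * D powr (1 + s) * (2 / D) = 2 * C * D powr s"
      using D by (simp add: powr_add)
    ultimately show ?thesis by simp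
  qed
  have "(\<Sum>c\<in>{c \<in> \<T>. fst c \<le> 2 ^ m}. 1 / real_of_int (fst c)) \<le> K * (2 ^ m) powr s"
  proof (induction m)
    case 0
    have "{c \<in> \<T>. fst c \<le> 2 ^ 0} = {c \<in> \<T>. 1 / 2 < real_of_int (fst c) \<and> real_of_int (fst c) \<le> 1}"
      using j by fastforce
    moreover have "2 * C \<le> K" unfolding K_def using s1 C
      by (simp add: pos_le_divide_eq mult_left_mono)
    ultimately show ?case using block[of 1] by simp
  next
    case (Suc m)
    let ?a = "{c \<in> \<T>. fst c \<le> 2 ^ m}"
    let ?b = "{c \<in> \<T>. 2 ^ Suc m / 2 < real_of_int (fst c) \<and> real_of_int (fst c) \<le> 2 ^ Suc m}"
    have iff: "real_of_int i \<le> 2 ^ n \<longleftrightarrow> i \<le> 2 ^ n" for i n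
      by (metis of_int_le_iff of_int_numeral of_int_power)
    have "?b = {c \<in> \<T>. \<not> fst c \<le> 2 ^ m \<and> fst c \<le> 2 ^ Suc m}"
      by (simp only: iff[symmetric] not_le) simp
    moreover have "x \<le> 2 ^ Suc m" if "x \<le> 2 ^ m" for x :: int
    proof -
      have "(0::int) \<le> 2 ^ m" by simp
      then show ?thesis using that unfolding power_Suc by linarith
    qed
    ultimately have "{c \<in> \<T>. fst c \<le> 2 ^ Suc m} = ?a \<union> ?b" "?a \<inter> ?b = {}" by blast+
    then have "(\<Sum>c\<in>{c \<in> \<T>. fst c \<le> 2 ^ Suc m}. 1 / real_of_int (fst c)) =
        (\<Sum>c\<in>?a. 1 / real_of_int (fst c)) + (\<Sum>c\<in>?b. 1 / real_of_int (fst c))"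
      using fin by (simp add: sum.union_disjoint)
    also have "\<dots> \<le> K * (2 ^ m) powr s + 2 * C * (2 ^ Suc m) powr s"
      by (intro add_mono Suc.IH block one_le_power) simp
    also have "\<dots> = K * (2 ^ Suc m) powr s"
    proof -
      have "(2 ^ Suc m) powr s = 2 powr s * (2 ^ m) powr s"
        unfolding power_Suc by (rule powr_mult)
      then have "K * (2 ^ m) powr s + 2 * C * (2 ^ Suc m) powr s = (K + 2 * C * 2 powr s) * (2 ^ m) powr s"
        by (simp add: distrib_right)
      also have "K + 2 * C * 2 powr s = K * 2 powr s"
      proof -
        have "K * (2 powr s - 1) = 2 * C * 2 powr s" using s s1 by (simp add: K_def)
        then show ?thesis by (simp add: right_diff_distrib)
      qed
      finally show ?thesis unfolding power_Suc by (simp add: powr_mult)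
    qed
    finally show ?case .
  qed
  then show ?thesis by (simp add: K_def)
qed

text \<open>The Legendre transform is pinched, and the tolerance 1/(4Q) is sparse for it at every
  size up to \<open>Q\<close>. Rounding \<open>E\<close> up to a power of two costs a factor
  2^s.\<close>

lemma recip_sum:
  assumes s: "sparse_exponent s" "0 < s" and f: "pinched f g l L" and AB: "A \<le> B"
  obtains K where "0 \<le> K"
    "\<And>Q d E \<T>. 1 \<le> Q \<Longrightarrow> finite \<T> \<Longrightarrow> \<T> \<subseteq> dual_planes f g l A B Q d \<Longrightarrow> 1 \<le> E \<Longrightarrow>
      (\<Sum>c\<in>{c \<in> \<T>. of_int (fst c) \<le> E}. 1 / real_of_int (fst c)) \<le> K * E powr s"
proof -
  define A' B' where "A' = g (A - 1 / sqrt l)" and "B' = g (B + 1 / sqrt l)"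
  have l: "0 < l" using f pinched_pos by auto
  have "0 < 1 / sqrt l" using l by simp
  then have AB': "A' \<le> B'"
    unfolding A'_def B'_def using AB by (intro pinched_slope_mono[OF f]) linarith
  note dual = pinched_legendre[OF f]
  obtain C where C: "0 \<le> C" "\<And>Q d. 1 \<le> Q \<Longrightarrow> 0 < d \<Longrightarrow> d \<le> 1 / (4 * Q) \<Longrightarrow>
      real (card (prim_triples (legendre f g) A' B' Q d)) \<le> C * Q powr (1 + s)"
    using s(1) dual AB' unfolding sparse_exponent_def by meson
  have s1: "1 < 2 powr s" using s by simp
  define K where "K = 2 * C * 2 powr s / (2 powr s - 1)"
  have K: "0 \<le> K" using C s1 by (simp add: K_def)
  show ?thesis
  proof (rule that)
    show "0 \<le> K * 2 powr s" using K by simp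
    fix Q d E :: real and \<T> assume Q: "1 \<le> Q" and T: "finite \<T>" "\<T> \<subseteq> dual_planes f g l A B Q d" and E: "1 \<le> E"
    obtain m :: nat where m: "E \<le> 2 ^ m" "2 ^ m \<le> 2 * E"
    proof -
      define m where "m = nat \<lceil>log 2 E\<rceil>"
      have "0 \<le> log 2 E" using E by simp
      then have "log 2 E \<le> real m" "real m \<le> log 2 E + 1" unfolding m_def by linarith+
      then have "E \<le> 2 powr real m" "2 powr real m \<le> 2 * E"
        using E by (simp_all add: log_le_iff powr_add le_log_iff[symmetric] powr_le_iff log_mult)
      then show ?thesis using that by (simp add: powr_realpow)
    qed
    have small: "1 / (4 * Q) \<le> 1 / (4 * D)" if "1 \<le> D" "D \<le> Q" for D
      using that by (intro divide_left_mono) auto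
    have "(\<Sum>c\<in>{c \<in> \<T>. of_int (fst c) \<le> E}. 1 / real_of_int (fst c)) \<le>
      (\<Sum>c\<in>{c \<in> \<T>. fst c \<le> 2 ^ m}. 1 / real_of_int (fst c))"
    proof (rule sum_mono2)
      show "finite {c \<in> \<T>. fst c \<le> 2 ^ m}" using T by simp
      have "fst c \<le> 2 ^ m" if "real_of_int (fst c) \<le> E" for c :: "int \<times> int \<times> int"
      proof -
        have "real_of_int (fst c) \<le> 2 ^ m" using that m by linarith
        then show ?thesis by (metis of_int_le_iff of_int_numeral of_int_power)
      qed
      then show "{c \<in> \<T>. real_of_int (fst c) \<le> E} \<subseteq> {c \<in> \<T>. fst c \<le> 2 ^ m}" by blast
      show "0 \<le> 1 / real_of_int (fst c)" if "c \<in> {c \<in> \<T>. fst c \<le> 2 ^ m} - {c \<in> \<T>. of_int (fst c) \<le> E}" for c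
        using that T by (auto simp: dual_planes_def)
    qed
    also have "\<dots> \<le> K * (2 ^ m) powr s"
      unfolding K_def
    proof (rule dyadic_recip_sum[OF T s(2) C(1)], fold A'_def B'_def)
      fix D assume D: "1 \<le> D" "D \<le> Q"
      interpret nc: near_curve "legendre f g" "conj_slope g" "l / L\<^sup>2" "L / l\<^sup>2" A' B' D "1 / (4 * Q)"
        using dual AB' D Q by unfold_locales auto
      show "finite (prim_triples (legendre f g) A' B' D (1 / (4 * Q)))" by (rule nc.finite_P)
      show "real (card (prim_triples (legendre f g) A' B' D (1 / (4 * Q)))) \<le> C * D powr (1 + s)"
        using C(2)[OF D(1) _ small[OF D]] Q by simp
    qed
    also have "\<dots> \<le> K * (2 * E) powr s"
      using m E K s by (intro mult_left_mono powr_mono2) auto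
    also have "\<dots> = K * 2 powr s * E powr s" using E by (simp add: powr_mult)
    finally show "(\<Sum>c\<in>{c \<in> \<T>. of_int (fst c) \<le> E}. 1 / real_of_int (fst c)) \<le> K * 2 powr s * E powr s" .
  qed
qed

lemma prim_triples_mono: "d \<le> d' \<Longrightarrow> prim_triples f A B Q d \<subseteq> prim_triples f A B Q d'"
  by (auto simp: prim_triples_def near_triples_def)

lemma main_const_nonneg:
  assumes "pinched f g l L" "A \<le> B"
  shows "0 \<le> main_const l L A B"
proof -
  have "0 < l" "0 < L" using pinched_pos[OF assms(1)] pinched_le[OF assms(1)] by auto
  then show ?thesis unfolding main_const_def using assms(2)
    by (intro add_nonneg_nonneg mult_nonneg_nonneg) auto
qed

text \<open>In the sum of 1/j the normals with j \<le> E contribute O(E^s) by the bound for the dual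
  curve, and the others O(Q/E) by their number.\<close>

lemma sparse_exponent_step:
  assumes s: "sparse_exponent s" "0 < s"
  shows "sparse_exponent (s / (1 + s))"
  unfolding sparse_exponent_def
proof (intro allI impI)
  fix f g :: "real \<Rightarrow> real" and l L A B :: real
  assume f: "pinched f g l L" and AB: "A \<le> B"
  obtain K where K: "0 \<le> K"
    "\<And>Q d E \<T>. 1 \<le> Q \<Longrightarrow> finite \<T> \<Longrightarrow> \<T> \<subseteq> dual_planes f g l A B Q d \<Longrightarrow> 1 \<le> E \<Longrightarrow>
      (\<Sum>c\<in>{c \<in> \<T>. of_int (fst c) \<le> E}. 1 / real_of_int (fst c)) \<le> K * E powr s"
    by (rule recip_sum[OF s f AB]) (rule that)
  define M where "M = main_const l L A B"
  have M: "0 \<le> M" using main_const_nonneg[OF f AB] by (simp add: M_def)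
  show "\<exists>C\<ge>0. \<forall>Q d. 1 \<le> Q \<longrightarrow> 0 < d \<longrightarrow> d \<le> 1 / (4 * Q) \<longrightarrow>
      real (card (prim_triples f A B Q d)) \<le> C * Q powr (1 + s / (1 + s))"
  proof (intro exI[of _ "M * (2 + K + 2 * M)"] conjI allI impI)
    show "0 \<le> M * (2 + K + 2 * M)" using M K by simp
    fix Q d :: real assume Q: "1 \<le> Q" and d: "0 < d" "d \<le> 1 / (4 * Q)"
    \<comment> \<open>The largest tolerance allowed; the count is monotone in \<open>d\<close>, and
      d' Q^2 is still at most \<open>Q\<close>.\<close>
    define d' where "d' = 1 / (4 * Q)"
    have d': "0 < d'" using Q by (simp add: d'_def)
    obtain \<T> where T: "finite \<T>" "\<T> \<subseteq> dual_planes f g l A B Q d'"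
      "real (card \<T>) \<le> M * (d' * Q\<^sup>2 + Q)"
      "real (card (prim_triples f A B Q d')) \<le> M *
        (d' * Q\<^sup>2 + Q + Q\<^sup>2 * sqrt (d' / Q) * (\<Sum>c\<in>\<T>. 1 / of_int (fst c)))"
      by (rule main_inequality[OF f AB Q d', folded M_def]) (rule that)
    define t where "t = s / (1 + s)"
    \<comment> \<open>This choice balances E^s against Q/E; both become Q^t.\<close>
    define E where "E = Q powr (1 / (1 + s))"
    have E1: "1 \<le> E" unfolding E_def using Q s by (intro ge_one_powr_ge_zero) auto
    have Es: "E powr s = Q powr t" by (simp add: E_def t_def powr_powr)
    have "1 - 1 / (1 + s) = t" using s by (simp add: t_def field_simps)
    then have QE: "Q / E = Q powr t" 
    using powr_diff[of Q 1 "1 / (1 + s)"] Q by (simp add: E_def)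
    have Qt: "1 \<le> Q powr t" unfolding t_def using Q s by (intro ge_one_powr_ge_zero) auto
    have dQ: "d' * Q\<^sup>2 + Q \<le> 2 * Q" using Q by (simp add: d'_def power2_eq_square)
    have "sqrt (d' / Q) = 1 / (2 * Q)"
      using Q by (intro real_sqrt_unique) (auto simp: d'_def power2_eq_square)
    then have sq: "Q\<^sup>2 * sqrt (d' / Q) = Q / 2" using Q by (simp add: power2_eq_square)
    have "(\<Sum>c\<in>\<T>. 1 / real_of_int (fst c)) =
        (\<Sum>c\<in>\<T> - {c \<in> \<T>. of_int (fst c) \<le> E}. 1 / real_of_int (fst c)) +
        (\<Sum>c\<in>{c \<in> \<T>. of_int (fst c) \<le> E}. 1 / real_of_int (fst c))"
      using T(1) by (intro sum.subset_diff) auto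
    also have "\<dots> \<le> 2 * M * Q powr t + K * Q powr t"
    proof (rule add_mono)
      show "(\<Sum>c\<in>{c \<in> \<T>. of_int (fst c) \<le> E}. 1 / real_of_int (fst c)) \<le> K * Q powr t"
        using K(2)[OF Q T(1,2) E1] Es by simp
      have "(\<Sum>c\<in>\<T> - {c \<in> \<T>. of_int (fst c) \<le> E}. 1 / real_of_int (fst c)) \<le>
          (\<Sum>c\<in>\<T> - {c \<in> \<T>. of_int (fst c) \<le> E}. 1 / E)"
        using E1 by (intro sum_mono divide_left_mono) auto
      also have "\<dots> = real (card (\<T> - {c \<in> \<T>. of_int (fst c) \<le> E})) * (1 / E)" by simp
      also have "\<dots> \<le> real (card \<T>) * (1 / E)"
        using T(1) E1 by (intro mult_right_mono of_nat_mono card_mono) auto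
      also have "\<dots> \<le> (M * (2 * Q)) * (1 / E)"
        using T(3) mult_left_mono[OF dQ M] E1 by (intro mult_right_mono) auto
      also have "\<dots> = 2 * M * (Q / E)" by simp
      also have "\<dots> = 2 * M * Q powr t" by (simp only: QE)
      finally show "(\<Sum>c\<in>\<T> - {c \<in> \<T>. of_int (fst c) \<le> E}. 1 / real_of_int (fst c)) \<le> 2 * M * Q powr t" .
    qed
    finally have sum: "(\<Sum>c\<in>\<T>. 1 / real_of_int (fst c)) \<le> (K + 2 * M) * Q powr t"
      by (simp add: algebra_simps)
    have "card (prim_triples f A B Q d) \<le> card (prim_triples f A B Q d')"
    proof (rule card_mono)
      interpret nc: near_curve f g l L A B Q d' using f AB Q d' by unfold_locales
      show "finite (prim_triples f A B Q d')" by (rule nc.finite_P)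
    qed (use d in \<open>auto simp: d'_def intro!: prim_triples_mono\<close>)
    then have "real (card (prim_triples f A B Q d)) \<le> M *
        (d' * Q\<^sup>2 + Q + Q\<^sup>2 * sqrt (d' / Q) * (\<Sum>c\<in>\<T>. 1 / of_int (fst c)))"
      using T(4) by linarith
    also have "\<dots> \<le> M * (2 * Q * Q powr t + Q / 2 * ((K + 2 * M) * Q powr t))"
      unfolding sq
    proof (intro mult_left_mono add_mono M)
      have "2 * Q * 1 \<le> 2 * Q * Q powr t" using Qt Q by (intro mult_left_mono) auto
      then show "d' * Q\<^sup>2 + Q \<le> 2 * Q * Q powr t" using dQ by linarith
    qed (use sum Q in auto)
    also have "\<dots> = M * (2 + (K + 2 * M) / 2) * (Q * Q powr t)" by (simp add: algebra_simps)
    also have "\<dots> \<le> M * (2 + K + 2 * M) * (Q * Q powr t)"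
      using M K Q by (intro mult_right_mono mult_left_mono) auto
    also have "Q * Q powr t = Q powr (1 + t)" using Q by (simp add: powr_add)
    finally show "real (card (prim_triples f A B Q d)) \<le> M * (2 + K + 2 * M) * Q powr (1 + s / (1 + s))"
      by (simp add: t_def)
  qed
qed

text \<open>Each step adds 1 to 1/s, so three of them lead from 1 to 1/4.\<close>

lemma sparse_exponent_quarter: "sparse_exponent (1 / 4)"
proof -
  have "sparse_exponent (1 / 2)" using sparse_exponent_step[OF sparse_exponent_1] by simp
  then have "sparse_exponent (1 / 3)" using sparse_exponent_step[of "1 / 2"] by simp
  then show ?thesis using sparse_exponent_step[of "1 / 3"] by simp
qed

text \<open>The normals satisfy j \<le> 1/d, so \<open>recip_sum\<close> with exponent 1/4 covers
  the full sum, and Q^2 (d/Q)^(1/2) d^(-1/4) = Q^(3/2) d^(1/4).\<close>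

lemma card_prim_triples:
  assumes f: "pinched f g l L" and AB: "A \<le> B"
  obtains C where "0 \<le> C" "\<And>Q d. 1 \<le> Q \<Longrightarrow> 0 < d \<Longrightarrow> d \<le> 1 \<Longrightarrow>
    real (card (prim_triples f A B Q d)) \<le> C * (d * Q\<^sup>2 + Q + Q powr (3 / 2) * d powr (1 / 4))"
proof -
  obtain K where K: "0 \<le> K"
    "\<And>Q d E \<T>. 1 \<le> Q \<Longrightarrow> finite \<T> \<Longrightarrow> \<T> \<subseteq> dual_planes f g l A B Q d \<Longrightarrow> 1 \<le> E \<Longrightarrow>
      (\<Sum>c\<in>{c \<in> \<T>. of_int (fst c) \<le> E}. 1 / real_of_int (fst c)) \<le> K * E powr (1 / 4)"
    by (rule recip_sum[OF sparse_exponent_quarter _ f AB]) (simp, rule that)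
  define M where "M = main_const l L A B"
  have M: "0 \<le> M" using main_const_nonneg[OF f AB] by (simp add: M_def)
  show ?thesis
  proof (rule that[of "M * (1 + K)"])
    show "0 \<le> M * (1 + K)" using M K by simp
    fix Q d :: real assume Q: "1 \<le> Q" and d: "0 < d" "d \<le> 1"
    obtain \<T> where T: "finite \<T>" "\<T> \<subseteq> dual_planes f g l A B Q d"
      "real (card (prim_triples f A B Q d)) \<le> M *
        (d * Q\<^sup>2 + Q + Q\<^sup>2 * sqrt (d / Q) * (\<Sum>c\<in>\<T>. 1 / of_int (fst c)))"
      by (rule main_inequality[OF f AB Q d(1), folded M_def]) (rule that)
    have "{c \<in> \<T>. of_int (fst c) \<le> 1 / d} = \<T>"
      using T(2) d by (auto simp: dual_planes_def field_simps)
    then have sum: "(\<Sum>c\<in>\<T>. 1 / real_of_int (fst c)) \<le> K * (1 / d) powr (1 / 4)"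
      using K(2)[OF Q T(1,2), of "1 / d"] d by simp
    define G where "G = Q powr (3 / 2) * d powr (1 / 4)"
    have "Q\<^sup>2 * sqrt (d / Q) * (1 / d) powr (1 / 4) = Q powr 2 * (d powr (1/2) / Q powr (1/2)) * (1 / d powr (1 / 4))"
      using Q d by (simp add: powr_half_sqrt[symmetric] powr_divide)
    also have "\<dots> = Q powr (2 - 1/2) * d powr (1/2 - 1/4)"
      by (simp only: powr_diff) simp
    finally have eq: "Q\<^sup>2 * sqrt (d / Q) * (1 / d) powr (1 / 4) = G" by (simp add: G_def)
    have "Q\<^sup>2 * sqrt (d / Q) * (\<Sum>c\<in>\<T>. 1 / real_of_int (fst c)) \<le>
        Q\<^sup>2 * sqrt (d / Q) * (K * (1 / d) powr (1 / 4))"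
      using sum Q d by (intro mult_left_mono) auto
    also have "\<dots> = K * G" unfolding eq[symmetric] by simp
    finally have "real (card (prim_triples f A B Q d)) \<le> M * (d * Q\<^sup>2 + Q + K * G)"
      using T(3) M by (meson add_left_mono mult_left_mono order_trans)
    also have "\<dots> \<le> M * ((1 + K) * (d * Q\<^sup>2 + Q + G))"
    proof (intro mult_left_mono M)
      have "0 \<le> K * (d * Q\<^sup>2 + Q)" "0 \<le> G" using K Q d by (auto simp: G_def)
      then show "d * Q\<^sup>2 + Q + K * G \<le> (1 + K) * (d * Q\<^sup>2 + Q + G)"
        by (simp add: algebra_simps)
    qed
    finally show "real (card (prim_triples f A B Q d)) \<le>
        M * (1 + K) * (d * Q\<^sup>2 + Q + Q powr (3 / 2) * d powr (1 / 4))" by (simp add: G_def)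
  qed
qed

section \<open>Common factors and dyadic ranges\<close>

text \<open>The term \<open>Q\<close> of \<open>card_prim_triples\<close> is raised to Q^(5/4) to
  make the sum over common factors converge. The final bound absorbs this, since for every
  \<open>d\<close> it is at least of order Q^(4/3).\<close>

definition size_bound :: "real \<Rightarrow> real \<Rightarrow> real"
  where "size_bound Q d = d * Q\<^sup>2 + Q powr (5 / 4) + Q powr (3 / 2) * d powr (1 / 4)"

lemma size_bound_nonneg: "0 \<le> d \<Longrightarrow> 0 \<le> size_bound Q d"
  by (simp add: size_bound_def)

text \<open>The terms gain the factors e^(-3), e^(-5/4) and e^(-7/4); for the middle one Q/e, which
  is at least 1, is first raised to the power 5/4.\<close>

lemma size_bound_scale:
  assumes Q: "1 \<le> Q" and d: "0 < d" and e: "1 \<le> e" "e \<le> Q"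
  shows "d / e * (Q / e)\<^sup>2 + Q / e + (Q / e) powr (3 / 2) * (d / e) powr (1 / 4) \<le>
    e powr (- 5 / 4) * size_bound Q d"
proof -
  have mono: "e powr - t \<le> e powr (- 5 / 4)" if "5 / 4 \<le> t" for t
    using e that by (intro powr_mono) auto
  have "d / e * (Q / e)\<^sup>2 = e powr - 3 * (d * Q\<^sup>2)"
    using e by (simp add: powr_minus powr_numeral divide_simps power2_eq_square power3_eq_cube)
  also have "\<dots> \<le> e powr (- 5 / 4) * (d * Q\<^sup>2)"
    using mono[of 3] d by (intro mult_right_mono) auto
  finally have 1: "d / e * (Q / e)\<^sup>2 \<le> e powr (- 5 / 4) * (d * Q\<^sup>2)" .
  have Qe: "1 \<le> Q / e" using e by simp
  have "(Q / e) powr 1 \<le> (Q / e) powr (5 / 4)" using Qe by (intro powr_mono) auto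
  also have "\<dots> = e powr (- 5 / 4) * Q powr (5 / 4)"
    using e Q by (simp add: powr_divide powr_minus_divide)
  finally have 2: "Q / e \<le> e powr (- 5 / 4) * Q powr (5 / 4)" using Q e by simp
  have "(Q / e) powr (3 / 2) * (d / e) powr (1 / 4) =
      Q powr (3 / 2) * d powr (1 / 4) / (e powr (3 / 2) * e powr (1 / 4))"
    using e Q d by (simp add: powr_divide)
  also have "e powr (3 / 2) * e powr (1 / 4) = e powr (7 / 4)" using e by (simp add: powr_add[symmetric])
  also have "Q powr (3 / 2) * d powr (1 / 4) / e powr (7 / 4) =
      e powr - (7 / 4) * (Q powr (3 / 2) * d powr (1 / 4))"
    by (simp add: powr_minus_divide)
  also have "\<dots> \<le> e powr (- 5 / 4) * (Q powr (3 / 2) * d powr (1 / 4))"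
    using mono[of "7 / 4"] by (intro mult_right_mono) auto
  finally show ?thesis using 1 2 unfolding size_bound_def by (simp only: distrib_left)
qed

text \<open>All exponents of \<open>Q\<close> are at least 1. This makes the sum over dyadic ranges
  geometric.\<close>

lemma size_bound_half:
  assumes "0 < Q" "0 < d"
  shows "size_bound (Q / 2) d \<le> size_bound Q d / 2"
proof -
  have *: "(Q / 2) powr t \<le> Q powr t / 2" if "1 \<le> t" for t
  proof -
    have "2 powr 1 \<le> (2 powr t :: real)" using that by (intro powr_mono) auto
    then have "Q powr t / 2 powr t \<le> Q powr t / 2" by (intro divide_left_mono) auto
    then show ?thesis using assms by (simp add: powr_divide)
  qed
  have "(Q / 2) powr (3 / 2) * d powr (1 / 4) \<le> Q powr (3 / 2) / 2 * d powr (1 / 4)"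
    by (intro mult_right_mono *) auto
  moreover have "d * (Q / 2)\<^sup>2 \<le> d * Q\<^sup>2 / 2" using assms by (simp add: power2_eq_square)
  ultimately show ?thesis using *[of "5 / 4"] by (simp add: size_bound_def)
qed

text \<open>The last term is the geometric mean of the two terms on the right. The term Q^(5/4) is
  at most the first of them if d \<ge> Q^(-1/2) and at most the second otherwise.\<close>

lemma size_bound_le:
  assumes Q: "1 \<le> Q" and d: "0 < d" "d \<le> 1"
  shows "size_bound Q d \<le> 3 * (d * Q\<^sup>2 + d powr (- 1 / 2) * Q)"
proof -
  define X Y where "X = d * Q\<^sup>2" and "Y = d powr (- 1 / 2) * Q"
  have X: "X = d powr 1 * Q powr 2" using Q d by (simp add: X_def)
  have Y: "Y = d powr (- 1 / 2) * Q powr 1" using Q by (simp add: Y_def)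
  have pos: "0 \<le> X" "0 \<le> Y" using Q d by (auto simp: X_def Y_def)
  have "(Q powr (3 / 2) * d powr (1 / 4))\<^sup>2 = Q powr (3 / 2 + 3 / 2) * d powr (1 / 4 + 1 / 4)"
    by (simp only: power2_eq_square powr_add mult_ac)
  moreover have "X * Y = Q powr (2 + 1) * d powr (1 + - 1 / 2)"
    by (simp only: X Y powr_add mult_ac)
  ultimately have "(Q powr (3 / 2) * d powr (1 / 4))\<^sup>2 = X * Y" by simp
  also have "\<dots> \<le> (X + Y)\<^sup>2" using pos by (simp add: power2_eq_square algebra_simps)
  finally have 1: "Q powr (3 / 2) * d powr (1 / 4) \<le> X + Y"
    by (rule power2_le_imp_le) (use pos in simp)
  have 2: "Q powr (5 / 4) \<le> X + Y"
  proof (cases "Q powr (- 1 / 2) \<le> d")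
    case True
    have "Q powr (5 / 4) \<le> Q powr (3 / 2)" using Q by (intro powr_mono) auto
    also have "\<dots> = Q powr (- 1 / 2) * Q powr 2" by (simp only: powr_add[symmetric]) simp
    also have "\<dots> \<le> d * Q powr 2" using True by (intro mult_right_mono) auto
    also have "\<dots> = X" using d by (simp add: X)
    finally show ?thesis using pos by linarith
  next
    case False
    have "Q powr (1 / 4) = (Q powr (- 1 / 2)) powr (- 1 / 2)" by (simp add: powr_powr)
    also have "\<dots> \<le> d powr (- 1 / 2)" using False d by (intro powr_mono2') auto
    finally have "Q powr (1 / 4) * Q powr 1 \<le> Y" unfolding Y by (intro mult_right_mono) auto
    then show ?thesis using pos by (simp only: powr_add[symmetric]) simp
  qed
  have "X + u + v \<le> 3 * (X + Y)" if "v \<le> X + Y" "u \<le> X + Y" for u v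
    using that pos by simp
  from this[OF 1 2] show ?thesis unfolding size_bound_def X_def Y_def .
qed

text \<open>Division by the common factor \<open>e\<close> keeps a/q and scales both
  \<open>Q\<close> and \<open>d\<close> by 1/e.\<close>

lemma near_triples_gcd:
  assumes "1 \<le> Q"
  shows "near_triples f A B Q d \<subseteq> (\<Union>e\<in>{1..nat \<lfloor>Q\<rfloor>}.
    (\<lambda>(q, a, p). (int e * q, int e * a, int e * p)) ` prim_triples f A B (Q / real e) (d / real e))"
proof
  fix v assume v: "v \<in> near_triples f A B Q d"
  obtain q a p where vq: "v = (q, a, p)" by (cases v)
  have D: "Q / 2 < of_int q" "of_int q \<le> Q" "A * of_int q \<le> of_int a" "of_int a \<le> B * of_int q"
    "\<bar>of_int q * f (of_int a / of_int q) - of_int p\<bar> \<le> d"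
    using v by (auto simp: near_triples_def vq)
  have q: "0 < q" using D(1) assms by linarith
  define e where "e = gcd q (gcd a p)"
  have e0: "0 < e" using q by (simp add: e_def)
  have "e dvd q" "e dvd a" "e dvd p" unfolding e_def by (auto intro: dvd_trans[OF gcd_dvd2])
  then obtain q' a' p' where qap: "q = e * q'" "a = e * a'" "p = e * p'" by (auto elim!: dvdE)
  define n where "n = nat e"
  have n: "int n = e" "0 < real n" "real_of_int e = real n" using e0 by (auto simp: n_def)
  have "e \<le> q" using \<open>e dvd q\<close> q by (simp add: zdvd_imp_le)
  then have "e \<le> \<lfloor>Q\<rfloor>" using D(2) by (simp add: le_floor_iff)
  then have nQ: "n \<in> {1..nat \<lfloor>Q\<rfloor>}" using e0 by (auto simp: n_def)
  have eq: "real_of_int q = real n * of_int q'" "real_of_int a = real n * of_int a'"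
    "real_of_int p = real n * of_int p'" by (simp_all add: qap n)
  have "primitive (q', a', p')"
  proof -
    have "e * gcd q' (gcd a' p') dvd gcd q (gcd a p)"
      unfolding qap by (intro gcd_greatest mult_dvd_mono dvd_refl) (auto intro: dvd_trans[OF gcd_dvd2])
    then have "e * gcd q' (gcd a' p') dvd e * 1" by (simp add: e_def)
    then show ?thesis using e0 by (simp add: primitive_def)
  qed
  moreover have "(q', a', p') \<in> near_triples f A B (Q / real n) (d / real n)"
  proof -
    have "\<bar>real n * (of_int q' * f (of_int a' / of_int q') - of_int p')\<bar> \<le> d"
      using D(5) n unfolding eq by (simp add: right_diff_distrib mult.assoc)
    then have "real n * \<bar>of_int q' * f (of_int a' / of_int q') - of_int p'\<bar> \<le> d"
      using n by (simp add: abs_mult)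
    moreover have "real n * (A * of_int q') \<le> real n * of_int a'" "real n * of_int a' \<le> real n * (B * of_int q')"
      using D(3,4) unfolding eq by (simp_all add: mult.left_commute)
    ultimately show ?thesis using n D(1,2) unfolding eq
      by (simp add: near_triples_def pos_le_divide_eq pos_divide_less_eq mult.commute)
  qed
  moreover have "v = (\<lambda>(q, a, p). (int n * q, int n * a, int n * p)) (q', a', p')"
    by (simp add: vq n qap)
  ultimately show "v \<in> (\<Union>e\<in>{1..nat \<lfloor>Q\<rfloor>}.
    (\<lambda>(q, a, p). (int e * q, int e * a, int e * p)) ` prim_triples f A B (Q / real e) (d / real e))"
    using nQ unfolding prim_triples_def by blast
qed

lemma card_near_triples:
  assumes f: "pinched f g l L" and AB: "A \<le> B"
  obtains C where "0 \<le> C" "\<And>Q d. 1 \<le> Q \<Longrightarrow> 0 < d \<Longrightarrow> d \<le> 1 \<Longrightarrow>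
    finite (near_triples f A B Q d) \<and> real (card (near_triples f A B Q d)) \<le> C * size_bound Q d"
proof -
  obtain C where C: "0 \<le> C" "\<And>Q d. 1 \<le> Q \<Longrightarrow> 0 < d \<Longrightarrow> d \<le> 1 \<Longrightarrow>
    real (card (prim_triples f A B Q d)) \<le> C * (d * Q\<^sup>2 + Q + Q powr (3 / 2) * d powr (1 / 4))"
    by (rule card_prim_triples[OF f AB]) (rule that)
  \<comment> \<open>The term at 0 is 0, as \<open>powr\<close> vanishes at base 0.\<close>
  define Z where "Z = (\<Sum>n. real n powr (- 5 / 4))"
  have sm: "summable (\<lambda>n. real n powr (- 5 / 4))" by (simp add: summable_real_powr_iff)
  have Z: "0 \<le> Z" unfolding Z_def using sm by (rule suminf_nonneg) simp
  show ?thesis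
  proof (rule that[of "C * Z"])
    show "0 \<le> C * Z" using C Z by simp
    fix Q d :: real assume Q: "1 \<le> Q" and d: "0 < d" "d \<le> 1"
    let ?E = "{1..nat \<lfloor>Q\<rfloor>}"
    let ?T = "\<lambda>e. (\<lambda>(q, a, p). (int e * q, int e * a, int e * p)) `
      prim_triples f A B (Q / real e) (d / real e)"
    have e: "1 \<le> real e" "real e \<le> Q" if "e \<in> ?E" for e using that Q by (auto simp: le_nat_floor) linarith+
    have d1: "d / real e \<le> 1" "0 < d / real e" if "e \<in> ?E" for e
      using e[OF that] d by (auto simp: field_simps)
    have fin: "finite (prim_triples f A B (Q / real e) (d / real e))" if "e \<in> ?E" for e
    proof -
      interpret nc: near_curve f g l L A B "Q / real e" "d / real e"
        using f AB e[OF that] d1[OF that] by unfold_locales auto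
      show ?thesis by (rule nc.finite_P)
    qed
    have finT: "finite (\<Union>e\<in>?E. ?T e)" using fin by auto
    have "card (near_triples f A B Q d) \<le> card (\<Union>e\<in>?E. ?T e)"
      using near_triples_gcd[OF Q] finT by (intro card_mono) auto
    also have "\<dots> \<le> (\<Sum>e\<in>?E. card (?T e))" by (intro card_UN_le) auto
    also have "\<dots> \<le> (\<Sum>e\<in>?E. card (prim_triples f A B (Q / real e) (d / real e)))"
      using fin by (intro sum_mono card_image_le) auto
    finally have "real (card (near_triples f A B Q d)) \<le>
        (\<Sum>e\<in>?E. real (card (prim_triples f A B (Q / real e) (d / real e))))"
      by (simp only: of_nat_sum[symmetric] of_nat_le_iff)
    also have "\<dots> \<le> (\<Sum>e\<in>?E. C * (real e powr (- 5 / 4) * size_bound Q d))"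
    proof (rule sum_mono)
      fix e assume "e \<in> ?E"
      note e = e[OF this] and d1 = d1[OF this]
      have "real (card (prim_triples f A B (Q / real e) (d / real e))) \<le>
        C * (d / e * (Q / e)\<^sup>2 + Q / e + (Q / e) powr (3 / 2) * (d / e) powr (1 / 4))"
        using e d1 by (intro C(2)) auto
      also have "\<dots> \<le> C * (real e powr (- 5 / 4) * size_bound Q d)"
        by (intro mult_left_mono size_bound_scale C(1) Q d e)
      finally show "real (card (prim_triples f A B (Q / real e) (d / real e))) \<le>
        C * (real e powr (- 5 / 4) * size_bound Q d)" .
    qed
    also have "\<dots> = C * (\<Sum>e\<in>?E. real e powr (- 5 / 4)) * size_bound Q d"
      by (simp add: sum_distrib_left sum_distrib_right mult.assoc)
    also have "\<dots> \<le> C * Z * size_bound Q d"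
      unfolding Z_def using sm C(1) d size_bound_nonneg[of d Q]
      by (intro mult_right_mono mult_left_mono sum_le_suminf) auto
    finally have "real (card (near_triples f A B Q d)) \<le> C * Z * size_bound Q d" .
    moreover have "finite (near_triples f A B Q d)"
      by (rule finite_subset[OF near_triples_gcd[OF Q] finT])
    ultimately show "finite (near_triples f A B Q d) \<and>
      real (card (near_triples f A B Q d)) \<le> C * Z * size_bound Q d" by simp
  qed
qed

lemma card_near_points_dyadic:
  assumes "finite (near_triples f \<eta> \<xi> Q \<delta>)"
  shows "near_count f \<eta> \<xi> Q \<delta> \<le> card (near_triples f \<eta> \<xi> Q \<delta>) + near_count f \<eta> \<xi> (Q / 2) \<delta>"
proof -
  let ?U = "{(a, q) \<in> near_points f \<eta> \<xi> Q \<delta>. Q / 2 < real q}"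
  \<comment> \<open>Any \<open>p\<close> within \<open>\<delta>\<close> serves, as the first two
    entries alone make the map injective.\<close>
  let ?h = "\<lambda>(a, q). (int q, a, SOME p::int. \<bar>real q * f (of_int a / real q) - of_int p\<bar> \<le> \<delta>)"
  have "near_points f \<eta> \<xi> Q \<delta> \<subseteq> ?U \<union> near_points f \<eta> \<xi> (Q / 2) \<delta>"
    by (auto simp: near_points_def)
  moreover have fin: "finite ?U" by (rule finite_subset[OF _ finite_near_points]) auto
  ultimately have "near_count f \<eta> \<xi> Q \<delta> \<le> card ?U + near_count f \<eta> \<xi> (Q / 2) \<delta>"
    unfolding near_count_def
    by (meson card_Un_le card_mono finite_UnI finite_near_points order_trans)
  moreover have "card ?U \<le> card (near_triples f \<eta> \<xi> Q \<delta>)"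
  proof (rule card_inj_on_le[OF _ _ assms])
    show "inj_on ?h ?U" by (rule inj_onI) auto
    show "?h ` ?U \<subseteq> near_triples f \<eta> \<xi> Q \<delta>"
    proof (intro image_subsetI)
      fix c assume c: "c \<in> ?U"
      obtain a q where aq: "c = (a, q)" by (cases c)
      obtain m where "dist_int (real q * f (of_int a / real q)) = \<bar>real q * f (of_int a / real q) - of_int m\<bar>"
        using dist_int_attained by blast
      then have "\<bar>real q * f (of_int a / real q) - of_int m\<bar> \<le> \<delta>"
        using c by (simp add: aq near_points_def)
      then have "\<bar>real q * f (of_int a / real q) -
          of_int (SOME p::int. \<bar>real q * f (of_int a / real q) - of_int p\<bar> \<le> \<delta>)\<bar> \<le> \<delta>"
        by (rule someI)
      then show "?h c \<in> near_triples f \<eta> \<xi> Q \<delta>"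
        using c by (simp add: aq near_points_def near_triples_def)
    qed
  qed
  ultimately show ?thesis by linarith
qed

lemma near_count_pinched:
  assumes f: "pinched f g l L" and "\<eta> < \<xi>"
  shows "\<exists>C>0. \<forall>Q \<delta> :: real. Q \<ge> 1 \<longrightarrow> 0 < \<delta> \<longrightarrow> \<delta> < 1 / 2 \<longrightarrow>
    real (near_count f \<eta> \<xi> Q \<delta>) \<le> C * (\<delta> * Q\<^sup>2 + \<delta> powr (- 1 / 2) * Q)"
proof -
  obtain C where C: "0 \<le> C" "\<And>Q d. 1 \<le> Q \<Longrightarrow> 0 < d \<Longrightarrow> d \<le> 1 \<Longrightarrow>
    finite (near_triples f \<eta> \<xi> Q d) \<and> real (card (near_triples f \<eta> \<xi> Q d)) \<le> C * size_bound Q d"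
    by (rule card_near_triples[OF f less_imp_le[OF assms(2)]]) (rule that)
  \<comment> \<open>\<open>n\<close> bounds the number of halvings of \<open>Q\<close> until no
    point is left. The factor 2 closes the induction: C + 2C/2 = 2C.\<close>
  have dyadic: "real (near_count f \<eta> \<xi> Q \<delta>) \<le> 2 * C * size_bound Q \<delta>"
    if "0 < Q" "Q < 2 ^ n" "0 < \<delta>" "\<delta> \<le> 1" for Q \<delta> n
    using that
  proof (induction n arbitrary: Q)
    case 0
    then have "near_points f \<eta> \<xi> Q \<delta> = {}" by (auto simp: near_points_def)
    then show ?case using C(1) size_bound_nonneg[of \<delta> Q] 0 by (simp add: near_count_def)
  next
    case (Suc n)
    show ?case
    proof (cases "Q < 1")
      case True
      then have "near_points f \<eta> \<xi> Q \<delta> = {}" by (auto simp: near_points_def)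
      then show ?thesis using C(1) size_bound_nonneg[of \<delta> Q] Suc by (simp add: near_count_def)
    next
      case False
      then have Q: "1 \<le> Q" by simp
      note T = C(2)[OF Q Suc.prems(3,4)]
      have "real (near_count f \<eta> \<xi> Q \<delta>) \<le>
        real (card (near_triples f \<eta> \<xi> Q \<delta>)) + real (near_count f \<eta> \<xi> (Q / 2) \<delta>)"
        using card_near_points_dyadic[OF conjunct1[OF T]] by linarith
      also have "\<dots> \<le> C * size_bound Q \<delta> + 2 * C * size_bound (Q / 2) \<delta>"
        using T Suc.prems by (intro add_mono Suc.IH) auto
      also have "\<dots> \<le> C * size_bound Q \<delta> + 2 * C * (size_bound Q \<delta> / 2)"
        using C(1) Suc.prems by (intro add_left_mono mult_left_mono size_bound_half) auto
      finally show ?thesis by simp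
    qed
  qed
  show ?thesis
  \<comment> \<open>The summand 1 makes the constant positive even if \<open>C\<close> is 0.\<close>
  proof (intro exI[of _ "6 * C + 1"] conjI allI impI)
    show "0 < 6 * C + 1" using C by simp
    fix Q \<delta> :: real assume Q: "1 \<le> Q" and \<delta>: "0 < \<delta>" "\<delta> < 1 / 2"
    obtain n where "Q < 2 ^ n" using real_arch_pow[of 2 Q] by auto
    then have "real (near_count f \<eta> \<xi> Q \<delta>) \<le> 2 * C * size_bound Q \<delta>"
      using Q \<delta> by (intro dyadic[of Q n]) auto
    also have "\<dots> \<le> 2 * C * (3 * (\<delta> * Q\<^sup>2 + \<delta> powr (- 1 / 2) * Q))"
      using C Q \<delta> by (intro mult_left_mono size_bound_le) auto
    also have "\<dots> = 6 * C * (\<delta> * Q\<^sup>2 + \<delta> powr (- 1 / 2) * Q)" by simp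
    also have "\<dots> \<le> (6 * C + 1) * (\<delta> * Q\<^sup>2 + \<delta> powr (- 1 / 2) * Q)"
      using Q \<delta> by (intro mult_right_mono) auto
    finally show "real (near_count f \<eta> \<xi> Q \<delta>) \<le> (6 * C + 1) * (\<delta> * Q\<^sup>2 + \<delta> powr (- 1 / 2) * Q)" .
  qed
qed

section \<open>Extension to the real line\<close>

text \<open>The difference of the two sides vanishes at \<open>x\<close>, and by the slope bounds
  its derivative has the sign of y - x or is 0.\<close>

lemma pinched_if_slope:
  assumes der: "\<And>x. (h has_real_derivative g x) (at x)" and l: "0 < l"
    and slope: "\<And>x y. x \<le> y \<Longrightarrow> l * (y - x) \<le> g y - g x \<and> g y - g x \<le> L * (y - x)"
  shows "pinched h g l L"
proof -
  have *: "0 \<le> \<phi> y" if \<phi>: "\<And>y. (\<phi> has_real_derivative D y) (at y)" "\<phi> x = 0"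
    and D: "\<And>y. x \<le> y \<Longrightarrow> 0 \<le> D y" "\<And>y. y \<le> x \<Longrightarrow> D y \<le> 0"
    for \<phi> D and x y :: real
  proof (cases "x \<le> y")
    case True
    then have "\<phi> x \<le> \<phi> y" by (rule DERIV_nonneg_imp_nondecreasing) (use \<phi> D in blast)
    then show ?thesis using \<phi> by simp
  next
    case False
    then have "y \<le> x" by simp
    then have "\<phi> x \<le> \<phi> y" by (rule DERIV_nonpos_imp_nonincreasing) (use \<phi> D in blast)
    then show ?thesis using \<phi> by simp
  qed
  show ?thesis unfolding pinched_def
  proof (intro conjI allI l)
    fix x y
    have "0 \<le> h y - (h x + g x * (y - x) + l / 2 * (y - x)\<^sup>2)"
    proof (rule *[where x = x and D = "\<lambda>y. g y - g x - l * (y - x)" and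
          \<phi> = "\<lambda>y. h y - (h x + g x * (y - x) + l / 2 * (y - x)\<^sup>2)"])
      show "((\<lambda>y. h y - (h x + g x * (y - x) + l / 2 * (y - x)\<^sup>2)) has_real_derivative
          g y - g x - l * (y - x)) (at y)" for y
        by (auto intro!: derivative_eq_intros der)
      show "g y - g x - l * (y - x) \<le> 0" if "y \<le> x" for y
        using slope[OF that] by (simp add: right_diff_distrib)
    qed (use slope in auto)
    then show "h x + g x * (y - x) + l / 2 * (y - x)\<^sup>2 \<le> h y" by simp
    have "0 \<le> (h x + g x * (y - x) + L / 2 * (y - x)\<^sup>2) - h y"
    proof (rule *[where x = x and D = "\<lambda>y. g x + L * (y - x) - g y" and
          \<phi> = "\<lambda>y. (h x + g x * (y - x) + L / 2 * (y - x)\<^sup>2) - h y"])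
      show "((\<lambda>y. (h x + g x * (y - x) + L / 2 * (y - x)\<^sup>2) - h y) has_real_derivative
          g x + L * (y - x) - g y) (at y)" for y
        by (auto intro!: derivative_eq_intros der)
      show "0 \<le> g x + L * (y - x) - g y" if "x \<le> y" for y
        using slope[OF that] by linarith
      show "g x + L * (y - x) - g y \<le> 0" if "y \<le> x" for y
        using slope[OF that] by (simp add: right_diff_distrib)
    qed auto
    then show "h y \<le> h x + g x * (y - x) + L / 2 * (y - x)\<^sup>2" by simp
  qed
qed

text \<open>Only the pieces through \<open>x\<close> matter: for a closed piece \<open>S\<close>
  without \<open>x\<close> the filter \<open>at x within S\<close> is trivial.\<close>

lemma has_derivative_closed_union:
  fixes h :: "real \<Rightarrow> real"
  assumes "finite \<S>" "\<Union>\<S> = UNIV" "\<And>S. S \<in> \<S> \<Longrightarrow> closed S"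
    and "\<And>S. S \<in> \<S> \<Longrightarrow> x \<in> S \<Longrightarrow> (h has_real_derivative D) (at x within S)"
  shows "(h has_real_derivative D) (at x)"
proof -
  have "(h has_real_derivative D) (at x within \<Union>\<S>)"
    using assms(1,3,4)
  proof (induction \<S> rule: finite_induct)
    case empty
    then show ?case by (simp add: has_field_derivative_iff)
  next
    case (insert S \<S>)
    have "(h has_real_derivative D) (at x within S)"
    proof (cases "x \<in> S")
      case False
      then have "x \<notin> closure (S - {x})" using insert.prems(1)[of S] by simp
      then have "at x within S = bot" by (simp add: at_within_eq_bot_iff)
      then show ?thesis by (simp add: has_field_derivative_iff)
    qed (use insert.prems in auto)
    moreover have "(h has_real_derivative D) (at x within \<Union>\<S>)"
      using insert by auto
    ultimately show ?case by (simp add: has_field_derivative_iff Lim_Un)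
  qed
  then show ?thesis by (simp add: assms(2))
qed

text \<open>Beyond each endpoint the function continues as the parabola with the same value and
  slope there and with second derivative \<open>l\<close>.\<close>

lemma pinched_extension:
  fixes f f' f'' :: "real \<Rightarrow> real"
  assumes "\<eta> < \<xi>"
    and f: "\<And>x. x \<in> {\<eta>..\<xi>} \<Longrightarrow> (f has_real_derivative f' x) (at x within {\<eta>..\<xi>})"
    and f': "\<And>x. x \<in> {\<eta>..\<xi>} \<Longrightarrow> (f' has_real_derivative f'' x) (at x within {\<eta>..\<xi>})"
    and l: "0 < l" and bounds: "\<And>x. x \<in> {\<eta>..\<xi>} \<Longrightarrow> l \<le> f'' x \<and> f'' x \<le> L"
  obtains h g where "pinched h g l L" "\<And>x. x \<in> {\<eta>..\<xi>} \<Longrightarrow> h x = f x"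
proof -
  have lL: "l \<le> L" using bounds[of \<eta>] assms(1) by auto
  have slope: "l * (y - x) \<le> f' y - f' x \<and> f' y - f' x \<le> L * (y - x)"
    if xy: "x \<in> {\<eta>..\<xi>}" "y \<in> {\<eta>..\<xi>}" "x \<le> y" for x y
  proof (cases "x = y")
    case False
    then have "x < y" using xy by simp
    have "\<exists>t\<in>{x<..<y}. f' y - f' x = f'' t * (y - x)"
    proof (rule mvt_simple[OF \<open>x < y\<close>, where f' = "\<lambda>t. (*) (f'' t)"])
      fix t assume t: "x \<le> t" "t \<le> y"
      then have "(f' has_real_derivative f'' t) (at t within {x..y})"
        using xy by (intro has_field_derivative_subset[OF f']) auto
      then show "(f' has_derivative (*) (f'' t)) (at t within {x..y})"
        by (simp add: has_field_derivative_def)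
    qed
    then obtain t where "t \<in> {x<..<y}" "f' y - f' x = f'' t * (y - x)" by blast
    then show ?thesis using bounds[of t] xy \<open>x < y\<close> by (auto intro: mult_right_mono)
  qed auto
  \<comment> \<open>\<open>\<pi>\<close> clamps to the interval, on which the correction terms of
    \<open>g\<close> and \<open>h\<close> vanish.\<close>
  define \<pi> where "\<pi> x = max \<eta> (min \<xi> x)" for x
  define g where "g x = f' (\<pi> x) + l * (x - \<pi> x)" for x
  define h where "h x = f (\<pi> x) + f' (\<pi> x) * (x - \<pi> x) + l / 2 * (x - \<pi> x)\<^sup>2" for x
  have \<pi>: "\<pi> x \<in> {\<eta>..\<xi>}" for x using assms(1) by (auto simp: \<pi>_def)
  have low: "\<pi> x = \<eta>" if "x \<le> \<eta>" for x using that assms(1) by (auto simp: \<pi>_def)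
  have mid: "\<pi> x = x" if "x \<in> {\<eta>..\<xi>}" for x using that by (auto simp: \<pi>_def)
  have high: "\<pi> x = \<xi>" if "\<xi> \<le> x" for x using that assms(1) by (auto simp: \<pi>_def)
  have "pinched h g l L"
  proof (rule pinched_if_slope[OF _ l])
    fix x
    have quad: "((\<lambda>x. f e + f' e * (x - e) + l / 2 * (x - e)\<^sup>2) has_real_derivative
        f' e + l * (x - e)) (at x within S)" for e S
      by (auto intro!: derivative_eq_intros)
    show "(h has_real_derivative g x) (at x)"
    proof (rule has_derivative_closed_union[where \<S> = "{{..\<eta>}, {\<eta>..\<xi>}, {\<xi>..}}"])
      show "\<Union>{{..\<eta>}, {\<eta>..\<xi>}, {\<xi>..}} = UNIV" by auto
      fix S assume S: "S \<in> {{..\<eta>}, {\<eta>..\<xi>}, {\<xi>..}}" and x: "x \<in> S"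
      consider "S = {..\<eta>}" | "S = {\<eta>..\<xi>}" | "S = {\<xi>..}" using S by blast
      then show "(h has_real_derivative g x) (at x within S)"
      proof cases
        case 1
        show ?thesis
          by (rule has_field_derivative_transform_within[OF _ zero_less_one x,
              where f = "\<lambda>x. f \<eta> + f' \<eta> * (x - \<eta>) + l / 2 * (x - \<eta>)\<^sup>2"])
            (use x low quad[of \<eta>] in \<open>auto simp: 1 h_def g_def\<close>)
      next
        case 2
        show ?thesis
          by (rule has_field_derivative_transform_within[OF _ zero_less_one x, where f = f])
            (use x mid f in \<open>auto simp: 2 h_def g_def\<close>)
      next
        case 3
        show ?thesis
          by (rule has_field_derivative_transform_within[OF _ zero_less_one x,
              where f = "\<lambda>x. f \<xi> + f' \<xi> * (x - \<xi>) + l / 2 * (x - \<xi>)\<^sup>2"])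
            (use x high quad[of \<xi>] in \<open>auto simp: 3 h_def g_def\<close>)
      qed
    qed auto
  next
    fix x y :: real assume xy: "x \<le> y"
    \<comment> \<open>Both \<open>\<pi>\<close> and its complement are nondecreasing, so an
      increment of \<open>g\<close> splits into one inside the interval and one of slope exactly
      \<open>l\<close>.\<close>
    have m: "\<pi> x \<le> \<pi> y" "x - \<pi> x \<le> y - \<pi> y" using xy assms(1) by (auto simp: \<pi>_def)
    have "l * ((y - \<pi> y) - (x - \<pi> x)) \<le> L * ((y - \<pi> y) - (x - \<pi> x))"
      using m lL by (intro mult_right_mono) auto
    then show "l * (y - x) \<le> g y - g x \<and> g y - g x \<le> L * (y - x)"
      using slope[OF \<pi> \<pi> m(1)] by (simp add: g_def algebra_simps)
  qed
  moreover have "h x = f x" if "x \<in> {\<eta>..\<xi>}" for x using mid[OF that] by (simp add: h_def)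
  ultimately show ?thesis using that by blast
qed

section \<open>Reduction of the theorem to pinched functions\<close>

lemma near_points_cong:
  assumes "\<And>x q. x \<in> {\<eta>..\<xi>} \<Longrightarrow> dist_int (real q * h x) = dist_int (real q * f x)"
  shows "near_points h \<eta> \<xi> Q \<delta> = near_points f \<eta> \<xi> Q \<delta>"
proof -
  have "dist_int (real q * h (of_int a / real q)) = dist_int (real q * f (of_int a / real q))"
    if "1 \<le> q" "\<eta> * real q < of_int a" "of_int a \<le> \<xi> * real q" for a q
    using that by (intro assms) (simp add: pos_le_divide_eq pos_divide_le_eq)
  then show ?thesis unfolding near_points_def by auto
qed

lemma dist_int_minus: "dist_int (- x) = dist_int x"
proof -
  have *: "dist_int (- x) \<le> dist_int x" for x
  proof -
    obtain m where "dist_int x = \<bar>x - of_int m\<bar>" using dist_int_attained by blast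
    then show ?thesis using dist_int_le[of "- x" "- m"] by simp
  qed
  from *[of x] *[of "- x"] show ?thesis by simp
qed

theorem theorem1p1:
  fixes f f' f'' :: "real \<Rightarrow> real" and \<eta> \<xi> :: real
  assumes "\<eta> < \<xi>"
    and "\<And>x. x \<in> {\<eta>..\<xi>} \<Longrightarrow> (f has_real_derivative f' x) (at x within {\<eta>..\<xi>})"
    and "\<And>x. x \<in> {\<eta>..\<xi>} \<Longrightarrow> (f' has_real_derivative f'' x) (at x within {\<eta>..\<xi>})"
    and "continuous_on {\<eta>..\<xi>} f''"
    and "\<exists>c>0. \<forall>x\<in>{\<eta>..\<xi>}. c \<le> \<bar>f'' x\<bar>"
  shows "\<exists>C>0. \<forall>Q \<delta> :: real. Q \<ge> 1 \<longrightarrow> 0 < \<delta> \<longrightarrow> \<delta> < 1 / 2 \<longrightarrow>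
           real (near_count f \<eta> \<xi> Q \<delta>) \<le> C * (\<delta> * Q\<^sup>2 + \<delta> powr (- 1 / 2) * Q)"
proof -
  obtain c where c: "0 < c" "\<And>x. x \<in> {\<eta>..\<xi>} \<Longrightarrow> c \<le> \<bar>f'' x\<bar>" using assms(5) by blast
  \<comment> \<open>Multiplication by \<open>s\<close> makes the second derivative positive at
    \<open>\<eta>\<close>, and then on the whole interval.\<close>
  define s where "s = sgn (f'' \<eta>)"
  have "\<bar>f'' \<eta>\<bar> > 0" using c(1) c(2)[of \<eta>] assms(1) by auto
  then have s: "s = 1 \<or> s = -1" "0 < s * f'' \<eta>" by (auto simp: s_def sgn_if)
  have cont: "continuous_on {\<eta>..\<xi>} (\<lambda>x. s * f'' x)" by (intro continuous_intros assms(4))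
  have abs: "\<bar>s * f'' x\<bar> = \<bar>f'' x\<bar>" for x using s(1) by auto
  \<comment> \<open>By the intermediate value theorem a change of sign would produce a zero of
    \<open>f''\<close>, against the lower bound \<open>c\<close>.\<close>
  have pos: "0 \<le> s * f'' x" if x: "x \<in> {\<eta>..\<xi>}" for x
  proof (rule ccontr)
    assume "\<not> 0 \<le> s * f'' x"
    then obtain t where "\<eta> \<le> t" "t \<le> x" "s * f'' t = 0"
      using IVT2'[of "\<lambda>x. s * f'' x" x 0 \<eta>] s(2) x continuous_on_subset[OF cont] by auto
    then show False using c(1) c(2)[of t] abs[of t] x by auto
  qed
  obtain L where L: "\<And>x. x \<in> {\<eta>..\<xi>} \<Longrightarrow> \<bar>s * f'' x\<bar> \<le> L"
  proof -
    have "bounded ((\<lambda>x. s * f'' x) ` {\<eta>..\<xi>})"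
      by (intro compact_imp_bounded compact_continuous_image cont compact_Icc)
    then obtain a where "\<forall>y\<in>(\<lambda>x. s * f'' x) ` {\<eta>..\<xi>}. \<bar>y\<bar> \<le> a"
      unfolding bounded_iff real_norm_def by blast
    then show ?thesis by (intro that[of a]) blast
  qed
  have bnd: "c \<le> s * f'' x \<and> s * f'' x \<le> L" if "x \<in> {\<eta>..\<xi>}" for x
    using c(2)[OF that] L[OF that] pos[OF that] abs[of x] by linarith
  obtain h g where h: "pinched h g c L" "\<And>x. x \<in> {\<eta>..\<xi>} \<Longrightarrow> h x = s * f x"
    by (rule pinched_extension[where f = "\<lambda>x. s * f x" and f' = "\<lambda>x. s * f' x" and
        f'' = "\<lambda>x. s * f'' x", OF assms(1) _ _ c(1) bnd])
      (use assms(2,3) in \<open>auto intro: DERIV_cmult\<close>)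
  \<comment> \<open>The distance to the nearest integer is even, so the sign \<open>s\<close> does
    not affect the count.\<close>
  have "dist_int (real q * h x) = dist_int (real q * f x)" if "x \<in> {\<eta>..\<xi>}" for x q
    using h(2)[OF that] s(1) by (auto simp: dist_int_minus)
  then have "near_points h \<eta> \<xi> Q \<delta> = near_points f \<eta> \<xi> Q \<delta>" for Q \<delta>
    by (rule near_points_cong)
  then have "near_count h \<eta> \<xi> = near_count f \<eta> \<xi>" by (intro ext) (simp add: near_count_def)
  then show ?thesis using near_count_pinched[OF h(1) assms(1)] by simp
qed

end
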